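(* For any integer $m\ge 2$ there exists a constant $C=C(m)$ such that for every $n\ge1$ $$C^{-1}\log(n+1)\le w_m(\ell_1^n)\le C\log(n+1).$$
   Context: $\ell_1^n$ is $\mathbb R^n$ with the $1$-norm. For a finite-dimensional real Banach space $X$ with closed unit ball $B_X$ and $f\in C(B_X)$ (continuous real-valued), let $E_m(f;B_X)=\inf_\varphi\max_{x\in B_X}|f(x)-\varphi(x)|$, the infimum over all real polynomials $\varphi$ on $X$ of total degree at most $m-1$; let $\Delta_h^m(f;x)=\sum_{j=0}^m(-1)^{m-j}\binom mj f(x+jh)$ and $\omega_m(f;B_X)=\sup|\Delta_h^m(f;x)|$, the supremum over all $x,h\in X$ with $x,x+h,\dots,x+mh\in B_X$. The Whitney constant is $w_m(X)=\sup\{E_m(f;B_X): f\in C(B_X),\ \omega_m(f;B_X)\le1\}$. *)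

theory Defs
  imports "HOL-Analysis.Analysis"
begin

text \<open>
  The dimension \<open>n\<close> is quantified inside the constant \<open>C\<close>, so it cannot be a type index.
  A vector of \<open>\<real>\<^sup>n\<close> is a function \<open>nat \<Rightarrow> real\<close> vanishing outside \<open>{..<n}\<close>, and an
  \<open>n\<close>-dimensional real Banach space is \<open>\<real>\<^sup>n\<close> with a norm \<open>N\<close>.
\<close>

definition Rn :: "nat \<Rightarrow> (nat \<Rightarrow> real) set" where
  "Rn n = {x. \<forall>i\<ge>n. x i = 0}"

definition l1_norm :: "nat \<Rightarrow> (nat \<Rightarrow> real) \<Rightarrow> real" where
  "l1_norm n x = (\<Sum>i<n. \<bar>x i\<bar>)"

definition unit_ball :: "nat \<Rightarrow> ((nat \<Rightarrow> real) \<Rightarrow> real) \<Rightarrow> (nat \<Rightarrow> real) set" where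
  "unit_ball n N = {x \<in> Rn n. N x \<le> 1}"

definition multi_indices :: "nat \<Rightarrow> nat \<Rightarrow> (nat \<Rightarrow> nat) set" where
  "multi_indices n d = {\<alpha>. (\<forall>i\<ge>n. \<alpha> i = 0) \<and> (\<Sum>i<n. \<alpha> i) \<le> d}"

text \<open>Without this, the sum over multi-indices below would collapse to \<open>0\<close>.\<close>

lemma finite_multi_indices: "finite (multi_indices n d)"
proof (rule finite_subset)
  show "multi_indices n d \<subseteq> {\<alpha>. \<forall>i. (i \<in> {..<n} \<longrightarrow> \<alpha> i \<in> {..d}) \<and> (i \<notin> {..<n} \<longrightarrow> \<alpha> i = 0)}"
  proof
    fix \<alpha> assume a: "\<alpha> \<in> multi_indices n d"
    have "\<alpha> i \<le> d" if "i < n" for i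
    proof -
      have "\<alpha> i \<le> (\<Sum>i<n. \<alpha> i)"
        using that by (intro member_le_sum) auto
      then show ?thesis
        using a by (simp add: multi_indices_def)
    qed
    then show "\<alpha> \<in> {\<alpha>. \<forall>i. (i \<in> {..<n} \<longrightarrow> \<alpha> i \<in> {..d}) \<and> (i \<notin> {..<n} \<longrightarrow> \<alpha> i = 0)}"
      using a by (auto simp: multi_indices_def)
  qed
  show "finite {\<alpha>. \<forall>i. (i \<in> {..<n} \<longrightarrow> \<alpha> i \<in> {..d}) \<and> (i \<notin> {..<n} \<longrightarrow> \<alpha> i = (0::nat))}"
    by (rule finite_set_of_finite_funs) auto
qed

definition polynomials :: "nat \<Rightarrow> nat \<Rightarrow> ((nat \<Rightarrow> real) \<Rightarrow> real) set" where
  "polynomials n d =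
     {\<phi>. \<exists>c :: (nat \<Rightarrow> nat) \<Rightarrow> real.
        \<phi> = (\<lambda>x. \<Sum>\<alpha>\<in>multi_indices n d. c \<alpha> * (\<Prod>i<n. x i ^ \<alpha> i))}"

text \<open>
  All suprema and infima are taken in \<open>ereal\<close>, so that an infinite value is not confused with
  a real number. Only the values of \<open>f\<close> on the ball matter below.
\<close>

definition best_approx :: "nat \<Rightarrow> nat \<Rightarrow> ((nat \<Rightarrow> real) \<Rightarrow> real) \<Rightarrow> ((nat \<Rightarrow> real) \<Rightarrow> real) \<Rightarrow> ereal" where
  "best_approx m n N f =
     (INF \<phi>\<in>polynomials n (m - 1). SUP x\<in>unit_ball n N. ereal \<bar>f x - \<phi> x\<bar>)"

definition fin_diff :: "nat \<Rightarrow> (nat \<Rightarrow> real) \<Rightarrow> ((nat \<Rightarrow> real) \<Rightarrow> real) \<Rightarrow> (nat \<Rightarrow> real) \<Rightarrow> real" where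
  "fin_diff m h f x =
     (\<Sum>j=0..m. (-1) ^ (m - j) * real (m choose j) * f (\<lambda>i. x i + real j * h i))"

definition smoothness_modulus :: "nat \<Rightarrow> nat \<Rightarrow> ((nat \<Rightarrow> real) \<Rightarrow> real) \<Rightarrow> ((nat \<Rightarrow> real) \<Rightarrow> real) \<Rightarrow> ereal" where
  "smoothness_modulus m n N f =
     (SUP (x, h) \<in> {(x, h). x \<in> Rn n \<and> h \<in> Rn n \<and>
                       (\<forall>j\<le>m. (\<lambda>i. x i + real j * h i) \<in> unit_ball n N)}.
        ereal \<bar>fin_diff m h f x\<bar>)"

text \<open>
  \<open>continuous_on\<close> refers to the product topology on \<open>nat \<Rightarrow> real\<close>. On \<open>Rn n\<close> it induces the
  Euclidean topology, which is the topology of every norm on \<open>\<real>\<^sup>n\<close>.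
\<close>

definition whitney_const :: "nat \<Rightarrow> nat \<Rightarrow> ((nat \<Rightarrow> real) \<Rightarrow> real) \<Rightarrow> ereal" where
  "whitney_const m n N =
     (SUP f \<in> {f. continuous_on (unit_ball n N) f \<and> smoothness_modulus m n N f \<le> 1}.
        best_approx m n N f)"

end

theory Submission
  imports Defs "HOL-Library.Function_Algebras" "HOL-Computational_Algebra.Polynomial"
begin

text \<open>
  Upper bound. If all \<open>m\<close>-th differences of \<open>f\<close> are at most \<open>1\<close>, then so are, up to a constant,
  its mixed differences of order \<open>m\<close> with small increments
  (\<open>almost_polynomial_if_differences_bounded\<close>). Hence the mixed difference
  \<open>F (h\<^sub>1, \<dots>, h\<^sub>m\<^sub>-\<^sub>1)\<close> of order \<open>m - 1\<close> at \<open>0\<close> is additive in each increment up to \<open>O(1)\<close>. An almost additive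
  function on the unit ball of \<open>\<ell>\<^sub>1\<^sup>n\<close> is within \<open>O(log n)\<close> of a linear one
  (\<open>almost_additive_near_linear\<close>): the two halves of the support of a vector can be treated
  separately at a bounded cost, and after about \<open>log n\<close> halvings only multiples of unit vectors are
  left. Doing this in each slot puts \<open>F\<close> within \<open>O(log n)\<close> of a multilinear form, and so
  \<open>F (x, \<dots>, x) / (m - 1)!\<close> within \<open>O(log n)\<close> of a homogeneous polynomial of degree \<open>m - 1\<close>. If \<open>f\<close> were a
  polynomial of degree \<open>m - 1\<close>, this would be its leading part; in general, subtracting it from \<open>f\<close> leaves a
  function whose mixed differences of order \<open>m - 1\<close> are \<open>O(1)\<close>, not merely \<open>O(log n)\<close>. Therefore
  induction on \<open>m\<close> loses a single logarithm (\<open>almost_polynomial_near_polynomial\<close>). The result holds on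
  a small ball and is carried to the unit ball along rays (\<open>near_polynomial_of_degree_less\<close>).

  Lower bound. The function \<open>\<Sum>i<n. x i * ln \<bar>x i\<bar>\<close> has second differences bounded by
  \<open>8 * \<Sum>i<n. \<bar>h i\<bar>\<close>, hence bounded differences of every order \<open>m \<ge> 2\<close> on the ball. A fixed linear
  combination of dilations extracts the linear part of a polynomial of degree less than \<open>m\<close> and
  changes this function only by a linear form. The function vanishes at all unit vectors, but at a
  multiple of their sum it has size of order \<open>log n\<close>, which no linear form can follow
  (\<open>entropy_far_from_polynomials\<close>).
\<close>

section \<open>Alternating binomial sums\<close>

text \<open>
  The \<open>m\<close>-th forward difference at \<open>0\<close> of the sequence \<open>a\<close>.
\<close>

definition altsum :: "nat \<Rightarrow> (nat \<Rightarrow> real) \<Rightarrow> real" where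
  "altsum m a = (\<Sum>j=0..m. (-1) ^ (m - j) * real (m choose j) * a j)"

lemma fin_diff_altsum: "fin_diff m h f x = altsum m (\<lambda>j. f (\<lambda>i. x i + real j * h i))"
  by (simp add: fin_diff_def altsum_def)

lemma altsum_0 [simp]: "altsum 0 a = a 0"
  by (simp add: altsum_def)

lemma altsum_cong: "(\<And>j. j \<le> m \<Longrightarrow> a j = b j) \<Longrightarrow> altsum m a = altsum m b"
  by (simp add: altsum_def)

lemma altsum_Suc: "altsum (Suc m) a = altsum m (\<lambda>j. a (Suc j) - a j)"
proof -
  let ?T = "\<Sum>j=0..m. (-1) ^ (m - j) * real (m choose Suc j) * a (Suc j)"
  have "altsum (Suc m) a = (-1) ^ Suc m * a 0 +
      (\<Sum>j=0..m. (-1) ^ (m - j) * real (Suc m choose Suc j) * a (Suc j))"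
    unfolding altsum_def by (subst sum.atLeast0_atMost_Suc_shift) simp
  also have "\<dots> = (-1) ^ Suc m * a 0 + altsum m (\<lambda>j. a (Suc j)) + ?T"
    by (simp add: altsum_def algebra_simps sum.distrib)
  also have "(-1) ^ Suc m * a 0 + ?T = - altsum m a"
  proof -
    have "(-1) ^ Suc m * a 0 + ?T = (\<Sum>j=0..Suc m. (-1) ^ (Suc m - j) * real (m choose j) * a j)"
      by (subst sum.atLeast0_atMost_Suc_shift) simp
    also have "\<dots> = (\<Sum>j=0..m. (-1) ^ (Suc m - j) * real (m choose j) * a j)"
      by simp
    also have "\<dots> = - altsum m a"
      unfolding altsum_def sum_negf[symmetric] by (intro sum.cong) (auto simp: Suc_diff_le)
    finally show ?thesis .
  qed
  then have "(-1) ^ Suc m * a 0 + altsum m (\<lambda>j. a (Suc j)) + ?T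
      = altsum m (\<lambda>j. a (Suc j)) - altsum m a" by linarith
  also have "\<dots> = altsum m (\<lambda>j. a (Suc j) - a j)"
    by (simp add: altsum_def sum_subtractf right_diff_distrib)
  finally show ?thesis .
qed

lemma altsum_diff: "altsum m (\<lambda>j. a j - b j) = altsum m a - altsum m b"
  by (simp add: altsum_def sum_subtractf right_diff_distrib)

lemma altsum_mult_right: "altsum m (\<lambda>j. a j * c) = altsum m a * c"
  by (simp add: altsum_def sum_distrib_right mult.assoc)

lemma altsum_sum: "altsum m (\<lambda>j. \<Sum>i\<in>I. a i j) = (\<Sum>i\<in>I. altsum m (a i))"
  unfolding altsum_def sum_distrib_left by (rule sum.swap)

lemma abs_altsum_le: "(\<And>j. j \<le> m \<Longrightarrow> \<bar>a j\<bar> \<le> B) \<Longrightarrow> \<bar>altsum m a\<bar> \<le> 2 ^ m * B"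
proof (induction m arbitrary: a B)
  case (Suc m)
  have "\<bar>a (Suc j) - a j\<bar> \<le> 2 * B" if "j \<le> m" for j
    using Suc.prems[of j] Suc.prems[of "Suc j"] that by linarith
  from Suc.IH[of "\<lambda>j. a (Suc j) - a j", OF this] show ?case by (simp add: altsum_Suc mult.commute mult.left_commute)
qed auto

text \<open>
  The \<open>m\<close>-th difference of a polynomial in one variable: each difference lowers the degree by one
  and multiplies the leading coefficient by the degree.
\<close>

lemma altsum_power:
  assumes "d \<le> m"
  shows "altsum m (\<lambda>j. real j ^ d) = (if d = m then fact m else 0)"
  using assms
proof (induction m arbitrary: d)
  case (Suc m)
  have pw: "real (Suc j) ^ d - real j ^ d = (\<Sum>e<d. real j ^ e * real (d choose e))" for j
  proof -
    have "real (Suc j) ^ d = (\<Sum>e\<le>d. real (d choose e) * real j ^ e)"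
      using binomial_ring[of "real j" 1 d] by (simp add: add.commute)
    also have "{..d} = insert d {..<d}" by auto
    finally show ?thesis by (simp add: mult.commute)
  qed
  have "altsum (Suc m) (\<lambda>j. real j ^ d)
      = (\<Sum>e<d. altsum m (\<lambda>j. real j ^ e) * real (d choose e))"
    unfolding altsum_Suc pw by (simp add: altsum_sum altsum_mult_right)
  also have "\<dots> = (\<Sum>e<d. if e = m then fact m * real (d choose m) else 0)"
    using Suc.prems by (intro sum.cong) (auto simp: Suc.IH)
  also have "\<dots> = (if d = Suc m then fact (Suc m) else 0)"
    using Suc.prems by (auto simp: sum.delta)
  finally show ?case .
qed auto

section \<open>Vectors and balls\<close>

text \<open>
  Used as rewrite rules, the pointwise laws also rewrite \<open>f (x + h)\<close> to
  \<open>f (\<lambda>i. x i + h i)\<close>, which hides sums of vectors from the laws of an abelian group.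
\<close>

declare plus_fun_apply [simp del] zero_fun_apply [simp del]

type_synonym vec = "nat \<Rightarrow> real"

definition scale :: "real \<Rightarrow> vec \<Rightarrow> vec" where
  "scale c x = (\<lambda>i. c * x i)"

lemma scale_apply: "scale c x i = c * x i"
  by (simp add: scale_def)

lemma scale_simps [simp]:
  "scale 0 x = 0" "scale 1 x = x" "scale c 0 = 0" "scale a (scale b x) = scale (a * b) x"
  by (auto simp: scale_def zero_fun_def)

lemma scale_add_left: "scale (a + b) x = scale a x + scale b x"
  by (auto simp: scale_def plus_fun_def algebra_simps)

lemma scale_add_right: "scale c (x + y) = scale c x + scale c y"
  by (auto simp: scale_def plus_fun_def algebra_simps)

definition l1_ball :: "nat \<Rightarrow> real \<Rightarrow> vec set" where
  "l1_ball n r = {x \<in> Rn n. l1_norm n x \<le> r}"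

lemma unit_ball_l1: "unit_ball n (l1_norm n) = l1_ball n 1"
  by (simp add: unit_ball_def l1_ball_def)

lemma l1_norm_scale [simp]: "l1_norm n (scale c x) = \<bar>c\<bar> * l1_norm n x"
  by (simp add: l1_norm_def scale_apply abs_mult sum_distrib_left)

lemma l1_norm_nonneg [simp]: "0 \<le> l1_norm n x"
  by (simp add: l1_norm_def sum_nonneg)

lemma l1_norm_add_le: "l1_norm n (x + y) \<le> l1_norm n x + l1_norm n y"
  unfolding l1_norm_def sum.distrib[symmetric] by (intro sum_mono) (simp add: plus_fun_def abs_triangle_ineq)

lemma l1_norm_0 [simp]: "l1_norm n 0 = 0"
  by (simp add: l1_norm_def zero_fun_def)

lemma Rn_closed: "x \<in> Rn n \<Longrightarrow> scale c x \<in> Rn n" "x \<in> Rn n \<Longrightarrow> y \<in> Rn n \<Longrightarrow> x + y \<in> Rn n"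
  "0 \<in> Rn n"
  by (auto simp: Rn_def scale_def plus_fun_def zero_fun_def)

lemma zero_in_l1_ball: "0 \<le> r \<Longrightarrow> 0 \<in> l1_ball n r"
  by (simp add: l1_ball_def Rn_closed)

lemma l1_ball_add: "x \<in> l1_ball n r \<Longrightarrow> y \<in> l1_ball n s \<Longrightarrow> x + y \<in> l1_ball n (r + s)"
  using l1_norm_add_le[of n x y] by (auto simp: l1_ball_def Rn_closed)

lemma l1_ball_scale: "x \<in> l1_ball n r \<Longrightarrow> \<bar>c\<bar> * r \<le> s \<Longrightarrow> scale c x \<in> l1_ball n s"
  unfolding l1_ball_def
  by (auto simp: Rn_closed) (meson abs_ge_zero mult_left_mono order_trans)

lemma l1_ball_mono: "x \<in> l1_ball n r \<Longrightarrow> r \<le> s \<Longrightarrow> x \<in> l1_ball n s"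
  by (auto simp: l1_ball_def)

section \<open>Almost additive functions on an \<open>\<ell>\<^sub>1\<close> ball\<close>

text \<open>
  Let \<open>d c = g c - c * g 1\<close> and let \<open>s\<close> be the supremum of \<open>\<bar>d\<bar>\<close> on \<open>[0, 1]\<close>. Halving the argument
  gives \<open>\<bar>d\<bar> \<le> (s + K) / 2\<close> on \<open>[0, 1/2]\<close>, and since \<open>d 1 = 0\<close> the reflection \<open>c \<mapsto> 1 - c\<close> carries
  this to \<open>[1/2, 1]\<close> at the cost of another \<open>K\<close>. Hence \<open>s \<le> s / 2 + 3 * K / 2\<close>, that is
  \<open>s \<le> 3 * K\<close>. Boundedness enters because \<open>s\<close> has to be finite: a discontinuous additive
  function would be a counterexample with \<open>K = 0\<close>.
\<close>

lemma almost_additive_near_linear_real: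
  fixes g :: "real \<Rightarrow> real"
  assumes add: "\<And>s t. \<bar>s\<bar> \<le> 1 \<Longrightarrow> \<bar>t\<bar> \<le> 1 \<Longrightarrow> \<bar>s + t\<bar> \<le> 1 \<Longrightarrow> \<bar>g (s + t) - g s - g t\<bar> \<le> K"
    and bounded: "\<And>t. \<bar>t\<bar> \<le> 1 \<Longrightarrow> \<bar>g t\<bar> \<le> M"
    and c: "\<bar>c\<bar> \<le> 1"
  shows "\<bar>g c - c * g 1\<bar> \<le> 5 * K"
proof -
  define d where "d c = g c - c * g 1" for c
  define s where "s = (SUP c\<in>{0..1}. \<bar>d c\<bar>)"
  have d_add: "\<bar>d (x + y) - d x - d y\<bar> \<le> K" if "\<bar>x\<bar> \<le> 1" "\<bar>y\<bar> \<le> 1" "\<bar>x + y\<bar> \<le> 1" for x y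
    using add[OF that] by (simp add: d_def algebra_simps)
  have bdd: "bdd_above ((\<lambda>c. \<bar>d c\<bar>) ` {0..1})"
  proof (rule bdd_aboveI2)
    fix x :: real assume "x \<in> {0..1}"
    then have "\<bar>x * g 1\<bar> \<le> 1 * M" unfolding abs_mult by (intro mult_mono bounded) auto
    then show "\<bar>d x\<bar> \<le> 2 * M" using bounded[of x] \<open>x \<in> {0..1}\<close> by (auto simp: d_def)
  qed
  have up: "\<bar>d x\<bar> \<le> s" if "x \<in> {0..1}" for x
    unfolding s_def using that by (intro cSUP_upper bdd)
  have low: "\<bar>d x\<bar> \<le> (s + K) / 2" if "0 \<le> x" "x \<le> 1/2" for x
    using d_add[of x x] up[of "2 * x"] that by (auto simp: abs_le_iff)
  have "s \<le> (s + K) / 2 + K" unfolding s_def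
  proof (rule cSUP_least, unfold s_def[symmetric])
    fix x :: real assume x: "x \<in> {0..1}"
    show "\<bar>d x\<bar> \<le> (s + K) / 2 + K"
    proof (cases "x \<le> 1/2")
      case True
      then show ?thesis using low[of x] x d_add[of 0 0] by (simp add: field_simps)
    next
      case False
      moreover have "d 1 = 0" by (simp add: d_def)
      ultimately show ?thesis using low[of "1 - x"] d_add[of x "1 - x"] x by (simp add: field_simps)
    qed
  qed simp
  then have s: "s \<le> 3 * K" by (simp add: field_simps)
  have K: "0 \<le> K" using d_add[of 0 0] by simp
  (* A negative argument is compared with its opposite; d 0 and the sum cost K each. *)
  have "\<bar>d c\<bar> \<le> 5 * K"
  proof (cases "0 \<le> c")
    case True
    then show ?thesis using up[of c] s K c by auto
  next
    case False
    then show ?thesis using up[of "-c"] s K c d_add[of c "-c"] d_add[of 0 0] by auto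
  qed
  then show ?thesis by (simp add: d_def)
qed

definition restrict_vec :: "nat set \<Rightarrow> vec \<Rightarrow> vec" where
  "restrict_vec A x = (\<lambda>i. if i \<in> A then x i else 0)"

definition spike :: "real \<Rightarrow> nat \<Rightarrow> vec" where
  "spike r i = (\<lambda>l. if l = i then r else 0)"

lemma spike_in_l1_ball: "i < n \<Longrightarrow> 0 \<le> r \<Longrightarrow> spike r i \<in> l1_ball n r"
  by (auto simp: l1_ball_def Rn_def spike_def l1_norm_def if_distrib[of abs] cong: if_cong)

lemma almost_additive_scale:
  assumes add: "\<And>u v. u \<in> l1_ball n r \<Longrightarrow> v \<in> l1_ball n r \<Longrightarrow> u + v \<in> l1_ball n r \<Longrightarrow>
        \<bar>p (u + v) - p u - p v\<bar> \<le> K"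
    and bounded: "\<And>u. u \<in> l1_ball n r \<Longrightarrow> \<bar>p u\<bar> \<le> M"
    and x: "x \<in> l1_ball n r" and c: "\<bar>c\<bar> \<le> 1"
  shows "\<bar>p (scale c x) - c * p x\<bar> \<le> 5 * K"
proof -
  have r: "0 \<le> r" using x l1_norm_nonneg[of n x] by (auto simp: l1_ball_def simp del: l1_norm_nonneg)
  have ball: "scale t x \<in> l1_ball n r" if "\<bar>t\<bar> \<le> 1" for t
    using that r by (intro l1_ball_scale[OF x]) (simp add: mult_left_le_one_le)
  have "\<bar>p (scale (s + t) x) - p (scale s x) - p (scale t x)\<bar> \<le> K"
    if "\<bar>s\<bar> \<le> 1" "\<bar>t\<bar> \<le> 1" "\<bar>s + t\<bar> \<le> 1" for s t
    using add[OF ball ball] ball[of "s + t"] that by (simp add: scale_add_left)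
  then have "\<bar>p (scale c x) - c * p (scale 1 x)\<bar> \<le> 5 * K"
    using bounded ball c by (intro almost_additive_near_linear_real[where M = M]) auto
  then show ?thesis by simp
qed

text \<open>
  Splitting a vector into two halves of its support costs only an additive \<open>O(K)\<close>: by almost
  homogeneity the bound \<open>T\<close> for vectors of half the support is weighted by the norms of the two
  parts, and in the \<open>1\<close>-norm these weights add up to at most \<open>1\<close>. The error therefore grows
  linearly in the number of halvings, which is logarithmic in the dimension. Each halving costs
  \<open>5 * K\<close> for either part and \<open>K\<close> for their sum.
\<close>

lemma almost_additive_halving:
  assumes add: "\<And>u v. u \<in> l1_ball n r \<Longrightarrow> v \<in> l1_ball n r \<Longrightarrow> u + v \<in> l1_ball n r \<Longrightarrow>
        \<bar>p (u + v) - p u - p v\<bar> \<le> K"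
    and bounded: "\<And>u. u \<in> l1_ball n r \<Longrightarrow> \<bar>p u\<bar> \<le> M"
    and spikes: "\<And>i. i < n \<Longrightarrow> p (spike r i) = 0"
    and r: "0 < r"
    and x: "x \<in> l1_ball n r" "{i. x i \<noteq> 0} \<subseteq> A" "A \<subseteq> {..<n}" "card A \<le> 2 ^ k"
  shows "\<bar>p x\<bar> \<le> 11 * K * (real k + 1)"
  using x
proof (induction k arbitrary: x A)
  case 0
  have K: "0 \<le> K" "\<bar>p 0\<bar> \<le> K" using add[of 0 0] zero_in_l1_ball[of r n] r by auto
  have fin: "finite A" using "0.prems"(3) finite_subset by blast
  show ?case
  proof (cases "A = {}")
    case True
    then have "x = 0" using "0.prems"(2) by (auto simp: zero_fun_def)
    then have "\<bar>p x\<bar> \<le> K" using K by (simp only:)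
    then show ?thesis using K by simp
  next
    case False
    then obtain i where A: "A = {i}"
      using "0.prems"(4) fin by (metis card_0_eq card_1_singletonE le_antisym less_one linorder_not_le power_0)
    then have i: "i < n" using "0.prems" by auto
    have xe: "x = scale (x i / r) (spike r i)"
    proof
      show "x j = scale (x i / r) (spike r i) j" for j
        using "0.prems"(2) A r by (cases "j = i") (auto simp: spike_def scale_def)
    qed
    have "\<bar>x i\<bar> \<le> l1_norm n x" unfolding l1_norm_def
      using i by (intro member_le_sum) auto
    then have "\<bar>x i / r\<bar> \<le> 1" using "0.prems"(1) r by (auto simp: l1_ball_def)
    then have "\<bar>p (scale (x i / r) (spike r i)) - x i / r * p (spike r i)\<bar> \<le> 5 * K"
      using i r spike_in_l1_ball[of i n r] by (intro almost_additive_scale[OF add bounded, where x = "spike r i"]) auto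
    then show ?thesis using spikes[OF i] K xe by simp
  qed
next
  case (Suc k)
  have K: "0 \<le> K" "\<bar>p 0\<bar> \<le> K" using add[of 0 0] zero_in_l1_ball[of r n] r by auto
  have fin: "finite A" using Suc.prems(3) finite_subset by blast
  obtain B where B: "B \<subseteq> A" "card B = card A div 2" "finite B"
    using obtain_subset_with_card_n[of "card A div 2" A] by auto
  define T where "T = 11 * K * (real k + 1)"
  (* Rescale a part to full norm r, apply the induction hypothesis, and scale back. *)
  have part: "\<bar>p y\<bar> \<le> l1_norm n y / r * T + 5 * K"
    if y: "y \<in> l1_ball n r" "{i. y i \<noteq> 0} \<subseteq> D" "D \<subseteq> {..<n}" "card D \<le> 2 ^ k" for y D
  proof (cases "l1_norm n y = 0")
    case True
    then have "y i = 0" for i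
      using y(1) by (cases "i < n") (auto simp: l1_norm_def l1_ball_def Rn_def sum_nonneg_eq_0_iff)
    then have "y = 0" by (auto simp: zero_fun_def)
    then have "\<bar>p y\<bar> \<le> K" using K by (simp only:)
    then show ?thesis using K True by simp
  next
    case False
    define a where "a = l1_norm n y"
    have a: "0 < a" "a \<le> r" using False y(1) by (auto simp: a_def l1_ball_def less_le)
    define z where "z = scale (r / a) y"
    have z: "z \<in> l1_ball n r" using y(1) a r by (auto simp: z_def l1_ball_def Rn_closed a_def[symmetric])
    have zT: "\<bar>p z\<bar> \<le> T" unfolding T_def
    proof (rule Suc.IH[OF z _ y(3,4)])
      show "{i. z i \<noteq> 0} \<subseteq> D" using y(2) by (auto simp: z_def scale_def)
    qed
    have yz: "y = scale (a / r) z" using a r by (simp add: z_def)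
    have "\<bar>p (scale (a / r) z) - a / r * p z\<bar> \<le> 5 * K"
      using a r z by (intro almost_additive_scale[OF add bounded, where x = z]) auto
    moreover have "\<bar>a / r * p z\<bar> \<le> a / r * T"
      unfolding abs_mult using a r zT by (intro mult_mono) auto
    ultimately show ?thesis unfolding a_def[symmetric] yz[symmetric] by linarith
  qed
  define y where "y = restrict_vec B x"
  define z where "z = restrict_vec (- B) x"
  have x: "x = y + z" by (auto simp: y_def z_def restrict_vec_def plus_fun_def)
  have norm: "l1_norm n x = l1_norm n y + l1_norm n z"
    unfolding l1_norm_def sum.distrib[symmetric]
    by (intro sum.cong) (auto simp: y_def z_def restrict_vec_def)
  have Rn: "y \<in> Rn n" "z \<in> Rn n" using Suc.prems(1)
    by (auto simp: y_def z_def restrict_vec_def l1_ball_def Rn_def)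
  have xr: "l1_norm n x \<le> r" using Suc.prems(1) by (simp add: l1_ball_def)
  have ball: "y \<in> l1_ball n r" "z \<in> l1_ball n r"
    using Rn xr norm l1_norm_nonneg[of n y] l1_norm_nonneg[of n z] by (auto simp: l1_ball_def simp del: l1_norm_nonneg)
  have "\<bar>p y\<bar> \<le> l1_norm n y / r * T + 5 * K"
    using B Suc.prems by (intro part[OF ball(1), of B]) (auto simp: y_def restrict_vec_def)
  moreover have "\<bar>p z\<bar> \<le> l1_norm n z / r * T + 5 * K"
    using B Suc.prems by (intro part[OF ball(2), of "A - B"])
      (auto simp: z_def restrict_vec_def card_Diff_subset)
  moreover have "\<bar>p x - p y - p z\<bar> \<le> K"
    using add[OF ball] Suc.prems(1) unfolding x by blast
  moreover have "l1_norm n y / r * T + l1_norm n z / r * T \<le> T"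
  proof -
    have "l1_norm n x / r * T \<le> 1 * T" using xr r K
      by (intro mult_right_mono) (auto simp: T_def)
    then show ?thesis by (simp add: norm add_divide_distrib distrib_right)
  qed
  ultimately have "\<bar>p x\<bar> \<le> T + 11 * K" by linarith
  then show ?case by (simp add: T_def algebra_simps)
qed

text \<open>
  The linear function that agrees with \<open>q\<close> at the vertices \<open>spike r i\<close> approximates \<open>q\<close>.
\<close>

lemma almost_additive_near_linear:
  assumes add: "\<And>u v. u \<in> l1_ball n r \<Longrightarrow> v \<in> l1_ball n r \<Longrightarrow> u + v \<in> l1_ball n r \<Longrightarrow>
        \<bar>q (u + v) - q u - q v\<bar> \<le> K"
    and bounded: "\<And>u. u \<in> l1_ball n r \<Longrightarrow> \<bar>q u\<bar> \<le> M"
    and r: "0 < r" and k: "n \<le> 2 ^ k" and x: "x \<in> l1_ball n r"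
  shows "\<bar>q x - (\<Sum>i<n. x i / r * q (spike r i))\<bar> \<le> 11 * K * (real k + 1)"
proof -
  define l where "l x = (\<Sum>i<n. x i / r * q (spike r i))" for x
  have l_add: "l (u + v) = l u + l v" for u v
    by (simp add: l_def plus_fun_def sum.distrib[symmetric] add_divide_distrib distrib_right)
  have l_spike: "l (spike r i) = q (spike r i)" if "i < n" for i
  proof -
    have "l (spike r i) = (\<Sum>j<n. if j = i then q (spike r i) else 0)"
      unfolding l_def using r by (intro sum.cong) (auto simp: spike_def)
    then show ?thesis using that by simp
  qed
  have M: "0 \<le> M" using bounded[of 0] zero_in_l1_ball[of r n] r by auto
  have l_bound: "\<bar>l u\<bar> \<le> M" if u: "u \<in> l1_ball n r" for u
  proof -
    have "\<bar>l u\<bar> \<le> (\<Sum>i<n. \<bar>u i\<bar> / r * M)" unfolding l_def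
    proof (rule order_trans[OF sum_abs], intro sum_mono)
      fix i assume "i \<in> {..<n}"
      then have "\<bar>q (spike r i)\<bar> \<le> M" using bounded spike_in_l1_ball r by simp
      then show "\<bar>u i / r * q (spike r i)\<bar> \<le> \<bar>u i\<bar> / r * M"
        using r by (simp add: abs_mult mult_left_mono divide_right_mono)
    qed
    also have "\<dots> = l1_norm n u / r * M"
      by (simp add: l1_norm_def sum_divide_distrib sum_distrib_right)
    also have "\<dots> \<le> 1 * M" using u r M by (intro mult_right_mono) (auto simp: l1_ball_def)
    finally show ?thesis by simp
  qed
  have "\<bar>q x - l x\<bar> \<le> 11 * K * (real k + 1)"
  proof (rule almost_additive_halving[where p = "\<lambda>x. q x - l x" and A = "{..<n}" and M = "2 * M"])
    show "\<bar>q (u + v) - l (u + v) - (q u - l u) - (q v - l v)\<bar> \<le> K"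
      if "u \<in> l1_ball n r" "v \<in> l1_ball n r" "u + v \<in> l1_ball n r" for u v
      using add[OF that] by (simp add: l_add)
    show "\<bar>q u - l u\<bar> \<le> 2 * M" if "u \<in> l1_ball n r" for u
      using bounded[OF that] l_bound[OF that] by linarith
    show "{i. x i \<noteq> 0} \<subseteq> {..<n}" using x by (auto simp: l1_ball_def Rn_def not_le[symmetric])
  qed (use x k r l_spike in auto)
  then show ?thesis by (simp add: l_def)
qed

section \<open>Mixed differences\<close>

primrec mixed_diff :: "vec list \<Rightarrow> (vec \<Rightarrow> real) \<Rightarrow> vec \<Rightarrow> real" where
  "mixed_diff [] f x = f x"
| "mixed_diff (h # hs) f x = mixed_diff hs f (x + h) - mixed_diff hs f x"

text \<open>
  This is \<open>\<Delta>\<^sub>u\<^sub>+\<^sub>v = \<Delta>\<^sub>u + \<Delta>\<^sub>v + \<Delta>\<^sub>u \<Delta>\<^sub>v\<close>: a mixed difference fails to be additive in one of its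
  increments by exactly a mixed difference of the next order at the same base point.
\<close>

lemma mixed_diff_slot:
  "mixed_diff (as @ (u + v) # bs) f x =
     mixed_diff (as @ u # bs) f x + mixed_diff (as @ v # bs) f x + mixed_diff (as @ u # v # bs) f x"
  by (induction as arbitrary: x) (simp_all add: add.assoc)

lemma abs_mixed_diff_le:
  assumes "\<And>y. \<bar>f y\<bar> \<le> M"
  shows "\<bar>mixed_diff hs f x\<bar> \<le> 2 ^ length hs * M"
proof (induction hs arbitrary: x)
  case (Cons h hs)
  have "\<bar>mixed_diff hs f (x + h) - mixed_diff hs f x\<bar> \<le> 2 ^ length hs * M + 2 ^ length hs * M"
    using Cons[of x] Cons[of "x + h"] by linarith
  then show ?case by (simp add: mult.commute mult.left_commute)
qed (use assms in auto)

lemma mixed_diff_diff: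
  "mixed_diff hs (\<lambda>x. f x - g x) y = mixed_diff hs f y - mixed_diff hs g y"
  by (induction hs arbitrary: y) auto

lemma mixed_diff_divide:
  "mixed_diff hs (\<lambda>x. f x / c) y = mixed_diff hs f y / c"
  by (induction hs arbitrary: y) (auto simp: diff_divide_distrib)

lemma mixed_diff_altsum:
  "mixed_diff hs (\<lambda>x. altsum m (\<lambda>j. g j x)) y = altsum m (\<lambda>j. mixed_diff hs (g j) y)"
  by (induction hs arbitrary: y) (auto simp: altsum_diff)

lemma mixed_diff_dilation:
  "mixed_diff hs (\<lambda>x. f (scale c x)) y = mixed_diff (map (scale c) hs) f (scale c y)"
  by (induction hs arbitrary: y) (auto simp: scale_add_right)

lemma mixed_diff_replicate:
  "mixed_diff (replicate m h) f x = altsum m (\<lambda>j. f (x + scale (real j) h))"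
proof (induction m arbitrary: x)
  case (Suc m)
  have "f (x + h + scale (real j) h) = f (x + scale (real (Suc j)) h)" for j
    using scale_add_left[of 1 "real j" h] by (simp add: add.assoc)
  then show ?case by (simp add: Suc altsum_Suc altsum_diff)
qed simp

lemma mixed_diff_zero: "0 \<in> set hs \<Longrightarrow> mixed_diff hs f x = 0"
  by (induction hs arbitrary: x) auto

text \<open>
  Djokovic's identity expresses a mixed difference by pure differences \<open>\<Delta>\<^sub>h\<^sup>m\<close>. Replace the
  \<open>i\<close>-th increment \<open>h\<^sub>i\<close> (counted from \<open>1\<close>) by \<open>(1 - j / i) h\<^sub>i\<close>, and take the alternating sum over \<open>j\<close>.
  For \<open>j = 0\<close> the increments are the original ones; for \<open>1 \<le> j \<le> m\<close> the \<open>j\<close>-th increment vanishes, so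
  only \<open>j = 0\<close> survives. On the other hand every evaluation point of the mixed difference is affine
  in \<open>j\<close>, so the alternating sum consists of \<open>2\<^sup>m\<close> pure differences.
\<close>

primrec staggered :: "nat \<Rightarrow> nat \<Rightarrow> vec list \<Rightarrow> vec list" where
  "staggered j i [] = []"
| "staggered j i (h # hs) = scale (1 - real j / real i) h # staggered j (Suc i) hs"

lemma staggered_0: "staggered 0 i hs = hs"
  by (induction hs arbitrary: i) auto

lemma zero_in_staggered: "0 < i \<Longrightarrow> i \<le> j \<Longrightarrow> j < i + length hs \<Longrightarrow> 0 \<in> set (staggered j i hs)"
proof (induction hs arbitrary: i)
  case (Cons h hs)
  show ?case
  proof (cases "i = j")
    case False
    then show ?thesis using Cons.IH[of "Suc i"] Cons.prems by auto
  qed (use Cons.prems in auto)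
qed auto

lemma abs_altsum_staggered_le:
  assumes diff: "\<And>x h. x \<in> Rn n \<Longrightarrow> h \<in> Rn n \<Longrightarrow> (\<And>j. j \<le> m \<Longrightarrow> x + scale (real j) h \<in> l1_ball n 1) \<Longrightarrow>
        \<bar>altsum m (\<lambda>j. f (x + scale (real j) h))\<bar> \<le> B"
    and i: "0 < i" and s: "0 \<le> s" and m: "0 < m"
    and hs: "set hs \<subseteq> l1_ball n s"
    and x: "x \<in> Rn n" "h \<in> Rn n"
      "\<And>j. j \<le> m \<Longrightarrow> x + scale (real j) h \<in> l1_ball n (1 - real (length hs) * (real m * s))"
  shows "\<bar>altsum m (\<lambda>j. mixed_diff (staggered j i hs) f (x + scale (real j) h))\<bar> \<le> 2 ^ length hs * B"
  using i hs x
proof (induction hs arbitrary: i x h)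
  case Nil
  then show ?case using diff by simp
next
  case (Cons g hs)
  let ?R = "1 - real (length hs) * (real m * s)"
  let ?D = "\<lambda>x h. altsum m (\<lambda>j. mixed_diff (staggered j (Suc i) hs) f (x + scale (real j) h))"
  have ms: "0 \<le> real m * s" using s by simp
  have g: "g \<in> l1_ball n s" using Cons.prems by simp
  have fixed: "\<bar>?D x h\<bar> \<le> 2 ^ length hs * B"
  proof (rule Cons.IH)
    show "x + scale (real j) h \<in> l1_ball n ?R" if "j \<le> m" for j
      using Cons.prems(5)[OF that] ms by (rule_tac l1_ball_mono) (auto simp: algebra_simps)
  qed (use Cons.prems in auto)
  have shift: "x + scale (real j) h + scale (1 - real j / real i) g
      = (x + g) + scale (real j) (h + scale (- 1 / real i) g)" for j
    by (auto simp: scale_def plus_fun_def algebra_simps)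
  have moved: "\<bar>?D (x + g) (h + scale (- 1 / real i) g)\<bar> \<le> 2 ^ length hs * B"
  proof (rule Cons.IH)
    fix j assume j: "j \<le> m"
    have "\<bar>1 - real j / real i\<bar> \<le> real m"
    proof -
      have "real j / real i \<le> real j / 1" using Cons.prems(1) by (intro divide_left_mono) auto
      moreover have "0 \<le> real j / real i" by simp
      moreover have "1 \<le> real m" using m by simp
      moreover have "real j \<le> real m" using j by simp
      ultimately show ?thesis unfolding abs_le_iff by linarith
    qed
    then have "scale (1 - real j / real i) g \<in> l1_ball n (real m * s)"
      using s by (intro l1_ball_scale[OF g] mult_right_mono) auto
    from l1_ball_add[OF Cons.prems(5)[OF j] this]
    show "x + g + scale (real j) (h + scale (- 1 / real i) g) \<in> l1_ball n ?R"
      unfolding shift[symmetric] by (rule l1_ball_mono) (simp add: algebra_simps)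
  qed (use Cons.prems g in \<open>auto simp: l1_ball_def Rn_closed\<close>)
  have "altsum m (\<lambda>j. mixed_diff (staggered j i (g # hs)) f (x + scale (real j) h))
      = ?D (x + g) (h + scale (- 1 / real i) g) - ?D x h"
    by (simp add: altsum_diff shift)
  then show ?case using fixed moved by (simp add: abs_le_iff)
qed

text \<open>
  The base point is fixed to be \<open>0\<close>, because by the slot identity such differences of order \<open>m\<close>
  already measure how far those of order \<open>m - 1\<close> at \<open>0\<close> are from being additive in a slot.
\<close>

definition almost_polynomial :: "nat \<Rightarrow> nat \<Rightarrow> real \<Rightarrow> real \<Rightarrow> (vec \<Rightarrow> real) \<Rightarrow> bool" where
  "almost_polynomial n m r K f \<longleftrightarrow>
     (\<forall>hs. length hs = m \<longrightarrow> set hs \<subseteq> l1_ball n r \<longrightarrow> \<bar>mixed_diff hs f 0\<bar> \<le> K)"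

text \<open>
  The radius \<open>1 / m\<^sup>2\<close> keeps all points in the unit ball: there are \<open>m\<close> increments, each stretched by
  a factor \<open>1 - j / i\<close> of absolute value at most \<open>m\<close>.
\<close>

lemma almost_polynomial_if_differences_bounded:
  assumes diff: "\<And>x h. x \<in> Rn n \<Longrightarrow> h \<in> Rn n \<Longrightarrow> (\<And>j. j \<le> m \<Longrightarrow> x + scale (real j) h \<in> l1_ball n 1) \<Longrightarrow>
        \<bar>altsum m (\<lambda>j. f (x + scale (real j) h))\<bar> \<le> 1"
    and m: "0 < m"
  shows "almost_polynomial n m (1 / real m ^ 2) (2 ^ m) f"
  unfolding almost_polynomial_def
proof (intro allI impI)
  fix hs assume hs: "length hs = m" "set hs \<subseteq> l1_ball n (1 / real m ^ 2)"
  have "\<bar>altsum m (\<lambda>j. mixed_diff (staggered j 1 hs) f (0 + scale (real j) 0))\<bar> \<le> 2 ^ length hs * 1"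
    by (rule abs_altsum_staggered_le[OF diff _ _ m hs(2)])
      (use m hs in \<open>auto simp: Rn_closed zero_in_l1_ball power2_eq_square\<close>)
  also have "altsum m (\<lambda>j. mixed_diff (staggered j 1 hs) f (0 + scale (real j) 0))
      = altsum m (\<lambda>j. (if j = 0 then 1 else 0) * mixed_diff hs f 0)"
    by (intro altsum_cong) (use hs in \<open>auto simp: staggered_0 intro!: mixed_diff_zero zero_in_staggered\<close>)
  also have "\<dots> = (-1) ^ m * mixed_diff hs f 0"
    unfolding altsum_mult_right by (simp add: altsum_def if_distrib[of "(*) _"] cong: if_cong)
  finally show "\<bar>mixed_diff hs f 0\<bar> \<le> 2 ^ m"
    using hs by (simp add: abs_mult power_abs)
qed

section \<open>Almost multiadditive functions\<close>

definition almost_multiadditive ::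
  "nat \<Rightarrow> real \<Rightarrow> real \<Rightarrow> nat \<Rightarrow> (vec list \<Rightarrow> real) \<Rightarrow> bool" where
  "almost_multiadditive n r K d F \<longleftrightarrow>
     (\<forall>as u v bs. length as + length bs + 1 = d \<longrightarrow> set as \<union> {u, v, u + v} \<union> set bs \<subseteq> l1_ball n r \<longrightarrow>
        \<bar>F (as @ (u + v) # bs) - F (as @ u # bs) - F (as @ v # bs)\<bar> \<le> K)"

lemma almost_multiadditive_mixed_diff:
  assumes "almost_polynomial n (Suc d) r K f"
  shows "almost_multiadditive n r K d (\<lambda>hs. mixed_diff hs f 0)"
  unfolding almost_multiadditive_def
proof (intro allI impI)
  fix as u v bs
  assume "length as + length bs + 1 = d" "set as \<union> {u, v, u + v} \<union> set bs \<subseteq> l1_ball n r"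
  then have "\<bar>mixed_diff (as @ u # v # bs) f 0\<bar> \<le> K"
    using assms by (simp add: almost_polynomial_def)
  then show "\<bar>mixed_diff (as @ (u + v) # bs) f 0 - mixed_diff (as @ u # bs) f 0
      - mixed_diff (as @ v # bs) f 0\<bar> \<le> K"
    by (simp add: mixed_diff_slot)
qed

lemma almost_multiadditive_Cons:
  assumes "almost_multiadditive n r K (Suc d) F" "z \<in> l1_ball n r"
  shows "almost_multiadditive n r K d (\<lambda>hs. F (z # hs))"
  unfolding almost_multiadditive_def
proof (intro allI impI)
  fix as u v bs
  assume "length as + length bs + 1 = d" "set as \<union> {u, v, u + v} \<union> set bs \<subseteq> l1_ball n r"
  then show "\<bar>F (z # as @ (u + v) # bs) - F (z # as @ u # bs) - F (z # as @ v # bs)\<bar> \<le> K"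
    using assms(1)[unfolded almost_multiadditive_def, rule_format, of "z # as" bs u v] assms(2) by auto
qed

lemma almost_multiadditive_hd:
  assumes "almost_multiadditive n r K (Suc (length hs)) F" "set hs \<subseteq> l1_ball n r"
    "u \<in> l1_ball n r" "v \<in> l1_ball n r" "u + v \<in> l1_ball n r"
  shows "\<bar>F ((u + v) # hs) - F (u # hs) - F (v # hs)\<bar> \<le> K"
  using assms(1)[unfolded almost_multiadditive_def, rule_format, of "[]" hs u v] assms(2-) by auto

text \<open>
  The multilinear function of \<open>hs\<close> that agrees with \<open>F\<close> on lists of vertices \<open>spike r i\<close>.
\<close>

primrec multilinear :: "nat \<Rightarrow> real \<Rightarrow> vec list \<Rightarrow> (vec list \<Rightarrow> real) \<Rightarrow> real" where
  "multilinear n r [] F = F []"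
| "multilinear n r (h # hs) F = (\<Sum>i<n. h i / r * multilinear n r hs (\<lambda>zs. F (spike r i # zs)))"

text \<open>
  The slots are linearised one after the other. The errors made in later slots enter with the
  weights \<open>h i / r\<close>, whose absolute values sum to at most \<open>1\<close>; so the logarithmic errors of the
  slots add up instead of multiplying.
\<close>

lemma almost_multiadditive_near_multilinear:
  assumes F: "almost_multiadditive n r K (length hs) F"
    and bounded: "\<And>zs. length zs = length hs \<Longrightarrow> set zs \<subseteq> l1_ball n r \<Longrightarrow> \<bar>F zs\<bar> \<le> M"
    and hs: "set hs \<subseteq> l1_ball n r" and r: "0 < r" and k: "n \<le> 2 ^ k"
  shows "\<bar>F hs - multilinear n r hs F\<bar> \<le> real (length hs) * (11 * K * (real k + 1))"
  using F bounded hs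
proof (induction hs arbitrary: F)
  case (Cons h hs)
  define T where "T = 11 * K * (real k + 1)"
  have h: "h \<in> l1_ball n r" "set hs \<subseteq> l1_ball n r" using Cons.prems by auto
  have first: "\<bar>F (h # hs) - (\<Sum>i<n. h i / r * F (spike r i # hs))\<bar> \<le> T"
    unfolding T_def
  proof (rule almost_additive_near_linear[where q = "\<lambda>h. F (h # hs)" and M = M])
    show "\<bar>F ((u + v) # hs) - F (u # hs) - F (v # hs)\<bar> \<le> K"
      if "u \<in> l1_ball n r" "v \<in> l1_ball n r" "u + v \<in> l1_ball n r" for u v
      using almost_multiadditive_hd[OF _ h(2) that] Cons.prems(1) by simp
  qed (use Cons.prems h r k in auto)
  have zero: "0 \<in> l1_ball n r" using r by (simp add: zero_in_l1_ball)
  have K: "0 \<le> K"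
    using almost_multiadditive_hd[of n r K hs F 0 0] Cons.prems(1) h zero by auto
  have rest: "\<bar>F (spike r i # hs) - multilinear n r hs (\<lambda>zs. F (spike r i # zs))\<bar> \<le> real (length hs) * T"
    if "i < n" for i
    unfolding T_def
  proof (rule Cons.IH)
    have sp: "spike r i \<in> l1_ball n r" using that r spike_in_l1_ball by simp
    show "almost_multiadditive n r K (length hs) (\<lambda>zs. F (spike r i # zs))"
      using almost_multiadditive_Cons[OF _ sp] Cons.prems(1) by simp
    show "\<bar>F (spike r i # zs)\<bar> \<le> M" if "length zs = length hs" "set zs \<subseteq> l1_ball n r" for zs
      using Cons.prems(2)[of "spike r i # zs"] that sp by simp
  qed (use h in auto)
  have "\<bar>(\<Sum>i<n. h i / r * F (spike r i # hs)) - multilinear n r (h # hs) F\<bar>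
      \<le> (\<Sum>i<n. \<bar>h i\<bar> / r * (real (length hs) * T))"
    unfolding multilinear.simps sum_subtractf[symmetric] right_diff_distrib[symmetric]
    by (rule order_trans[OF sum_abs], intro sum_mono) (use rest r in \<open>auto simp: abs_mult intro!: mult_left_mono divide_right_mono\<close>)
  also have "\<dots> = l1_norm n h / r * (real (length hs) * T)"
    by (simp add: l1_norm_def sum_divide_distrib sum_distrib_right)
  also have "\<dots> \<le> 1 * (real (length hs) * T)"
    using h(1) r K by (intro mult_right_mono) (auto simp: l1_ball_def T_def)
  finally have "\<bar>F (h # hs) - multilinear n r (h # hs) F\<bar> \<le> T + real (length hs) * T"
    using first by linarith
  then show ?case unfolding T_def[symmetric] by (simp add: distrib_right)
qed simp

text \<open>
  An almost additive slot is almost homogeneous for integer factors, with an error that does not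
  depend on the dimension.
\<close>

lemma almost_multiadditive_scale:
  assumes F: "almost_multiadditive n r K (length hs) F"
    and hs: "set hs \<subseteq> l1_ball n s" and s: "0 \<le> s" "s \<le> r" "real j * s \<le> r"
  shows "\<bar>F (map (scale (real j)) hs) - real j ^ length hs * F hs\<bar>
    \<le> real (length hs) * (real j + 1) ^ length hs * K"
  using F hs
proof (induction hs arbitrary: F)
  case (Cons h hs)
  define zs where "zs = map (scale (real j)) hs"
  have h: "h \<in> l1_ball n s" "set hs \<subseteq> l1_ball n s" using Cons.prems by auto
  have hr: "scale (real i) h \<in> l1_ball n r" if "i \<le> j" for i
  proof (rule l1_ball_scale[OF h(1)])
    have "real i * s \<le> real j * s" using that s by (intro mult_right_mono) auto
    then show "\<bar>real i\<bar> * s \<le> r" using s by simp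
  qed
  have h1: "h \<in> l1_ball n r" using h s l1_ball_mono by blast
  have zs: "set zs \<subseteq> l1_ball n r" "length zs = length hs"
    using h(2) s by (auto simp: zs_def intro!: l1_ball_scale)
  have add: "\<bar>F ((u + v) # zs) - F (u # zs) - F (v # zs)\<bar> \<le> K"
    if "u \<in> l1_ball n r" "v \<in> l1_ball n r" "u + v \<in> l1_ball n r" for u v
    using almost_multiadditive_hd[OF _ zs(1) that] Cons.prems(1) zs(2) by simp
  have zero: "0 \<in> l1_ball n r" using s by (simp add: zero_in_l1_ball)
  have K: "0 \<le> K" "\<bar>F (0 # zs)\<bar> \<le> K" using add[OF zero zero] zero by auto
  have hd: "\<bar>F (scale (real i) h # zs) - real i * F (h # zs)\<bar> \<le> (real i + 1) * K" if "i \<le> j" for i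
    using that
  proof (induction i)
    case 0
    then show ?case using K by simp
  next
    case (Suc i)
    have eq: "scale (real (Suc i)) h = scale (real i) h + h"
      using scale_add_left[of "real i" 1 h] by (simp add: add.commute)
    have "\<bar>F (scale (real (Suc i)) h # zs) - F (scale (real i) h # zs) - F (h # zs)\<bar> \<le> K"
      using add[of "scale (real i) h" h] hr[of i] hr[of "Suc i"] h1 Suc.prems unfolding eq by simp
    moreover have "\<bar>F (scale (real i) h # zs) - real i * F (h # zs)\<bar> \<le> (real i + 1) * K"
      using Suc by simp
    ultimately show ?case by (simp add: algebra_simps abs_le_iff)
  qed
  let ?l = "real (length hs)" and ?p = "(real j + 1) ^ length hs"
  have tl: "\<bar>F (h # zs) - real j ^ length hs * F (h # hs)\<bar> \<le> ?l * ?p * K"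
    unfolding zs_def
    by (rule Cons.IH) (use almost_multiadditive_Cons[OF _ h1] Cons.prems h in auto)
  have "\<bar>real j * (F (h # zs) - real j ^ length hs * F (h # hs))\<bar> \<le> real j * (?l * ?p * K)"
    unfolding abs_mult using tl by (intro mult_mono) auto
  then have "\<bar>F (scale (real j) h # zs) - real j ^ Suc (length hs) * F (h # hs)\<bar>
      \<le> (real j + 1) * K + real j * (?l * ?p * K)"
    using hd[of j] by (simp add: algebra_simps abs_le_iff)
  also have "\<dots> \<le> (real j + 1) * (?p * K) + (real j + 1) * (?l * ?p * K)"
  proof (intro add_mono mult_left_mono mult_right_mono)
    have "1 * K \<le> ?p * K" using K by (intro mult_right_mono one_le_power) auto
    then show "K \<le> ?p * K" by simp
  qed (use K in auto)
  also have "\<dots> = real (length (h # hs)) * (real j + 1) ^ length (h # hs) * K"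
    by (simp add: algebra_simps)
  finally show ?case by (simp add: zs_def)
qed simp

section \<open>Polynomials\<close>

lemma polynomialsI:
  assumes "\<And>x. f x = (\<Sum>\<alpha>\<in>multi_indices n d. c \<alpha> * (\<Prod>i<n. x i ^ \<alpha> i))"
  shows "f \<in> polynomials n d"
  unfolding polynomials_def using assms by (intro CollectI exI[of _ c] ext)

lemma polynomials_const: "(\<lambda>x. b) \<in> polynomials n d"
  unfolding polynomials_def
proof (intro CollectI exI[of _ "\<lambda>\<alpha>. if \<alpha> = (\<lambda>i. 0) then b else 0"] ext)
  fix x :: "nat \<Rightarrow> real"
  have "(\<Sum>\<alpha>\<in>multi_indices n d. (if \<alpha> = (\<lambda>i. 0) then b else 0) * (\<Prod>i<n. x i ^ \<alpha> i))
      = (\<Sum>\<alpha>\<in>multi_indices n d. if \<alpha> = (\<lambda>i. 0) then b else 0)"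
    by (intro sum.cong) auto
  also have "\<dots> = b"
    by (simp add: finite_multi_indices) (simp add: multi_indices_def)
  finally show "b = (\<Sum>\<alpha>\<in>multi_indices n d. (if \<alpha> = (\<lambda>i. 0) then b else 0) * (\<Prod>i<n. x i ^ \<alpha> i))"
    by simp
qed

lemma polynomials_add:
  assumes "f \<in> polynomials n d" "g \<in> polynomials n d"
  shows "(\<lambda>x. f x + g x) \<in> polynomials n d"
proof -
  obtain a b where "f = (\<lambda>x. \<Sum>\<alpha>\<in>multi_indices n d. a \<alpha> * (\<Prod>i<n. x i ^ \<alpha> i))"
    "g = (\<lambda>x. \<Sum>\<alpha>\<in>multi_indices n d. b \<alpha> * (\<Prod>i<n. x i ^ \<alpha> i))"
    using assms unfolding polynomials_def by auto
  then show ?thesis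
    by (intro polynomialsI[where c = "\<lambda>\<alpha>. a \<alpha> + b \<alpha>"]) (simp add: sum.distrib distrib_right)
qed

lemma polynomials_cmult:
  assumes "f \<in> polynomials n d"
  shows "(\<lambda>x. c * f x) \<in> polynomials n d"
proof -
  obtain a where "f = (\<lambda>x. \<Sum>\<alpha>\<in>multi_indices n d. a \<alpha> * (\<Prod>i<n. x i ^ \<alpha> i))"
    using assms unfolding polynomials_def by auto
  then show ?thesis
    by (intro polynomialsI[where c = "\<lambda>\<alpha>. c * a \<alpha>"]) (simp add: sum_distrib_left mult.assoc)
qed

lemma polynomials_sum:
  "finite I \<Longrightarrow> (\<And>i. i \<in> I \<Longrightarrow> f i \<in> polynomials n d) \<Longrightarrow> (\<lambda>x. \<Sum>i\<in>I. f i x) \<in> polynomials n d"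
  by (induction I rule: finite_induct) (auto intro: polynomials_const polynomials_add)

lemma polynomials_mono:
  assumes "f \<in> polynomials n d" "d \<le> e"
  shows "f \<in> polynomials n e"
proof -
  obtain a where a: "f = (\<lambda>x. \<Sum>\<alpha>\<in>multi_indices n d. a \<alpha> * (\<Prod>i<n. x i ^ \<alpha> i))"
    using assms unfolding polynomials_def by auto
  have sub: "multi_indices n d \<subseteq> multi_indices n e"
    using assms(2) by (auto simp: multi_indices_def)
  show ?thesis
    by (rule polynomialsI[where c = "\<lambda>\<alpha>. if \<alpha> \<in> multi_indices n d then a \<alpha> else 0"], unfold a)
      (intro sum.mono_neutral_cong_left finite_multi_indices sub, auto)
qed

lemma polynomials_coord_mult:
  assumes "f \<in> polynomials n d" "i < n"
  shows "(\<lambda>x. x i * f x) \<in> polynomials n (Suc d)"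
proof -
  obtain a where a: "f = (\<lambda>x. \<Sum>\<alpha>\<in>multi_indices n d. a \<alpha> * (\<Prod>i<n. x i ^ \<alpha> i))"
    using assms unfolding polynomials_def by auto
  define up where "up \<alpha> = \<alpha>(i := Suc (\<alpha> i))" for \<alpha> :: "nat \<Rightarrow> nat"
  define down where "down \<beta> = \<beta>(i := \<beta> i - 1)" for \<beta> :: "nat \<Rightarrow> nat"
  have down_up [simp]: "down (up \<alpha>) = \<alpha>" for \<alpha> by (auto simp: up_def down_def)
  have up_sum: "(\<Sum>l<n. up \<alpha> l) = Suc (\<Sum>l<n. \<alpha> l)" for \<alpha>
    using assms(2) by (simp add: up_def sum.remove[of "{..<n}" i])
  have img: "up ` multi_indices n d \<subseteq> multi_indices n (Suc d)"
    using assms(2) up_sum by (auto simp: multi_indices_def) (auto simp: up_def)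
  have mon: "(\<Prod>l<n. x l ^ up \<alpha> l) = x i * (\<Prod>l<n. x l ^ \<alpha> l)" for \<alpha> and x :: "nat \<Rightarrow> real"
    using assms(2) by (simp add: up_def prod.remove[of "{..<n}" i])
  have "x i * f x = (\<Sum>\<beta>\<in>multi_indices n (Suc d).
      (if \<beta> \<in> up ` multi_indices n d then a (down \<beta>) else 0) * (\<Prod>l<n. x l ^ \<beta> l))" for x
  proof -
    have inj: "inj_on up (multi_indices n d)" by (rule inj_on_inverseI[of _ down]) simp
    have "x i * f x = (\<Sum>\<alpha>\<in>multi_indices n d. a (down (up \<alpha>)) * (\<Prod>l<n. x l ^ up \<alpha> l))"
      unfolding a sum_distrib_left mon by (intro sum.cong) auto
    also have "\<dots> = (\<Sum>\<beta>\<in>up ` multi_indices n d. a (down \<beta>) * (\<Prod>l<n. x l ^ \<beta> l))"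
      by (simp add: sum.reindex[OF inj])
    also have "\<dots> = (\<Sum>\<beta>\<in>multi_indices n (Suc d).
      (if \<beta> \<in> up ` multi_indices n d then a (down \<beta>) else 0) * (\<Prod>l<n. x l ^ \<beta> l))"
      by (intro sum.mono_neutral_cong_left finite_multi_indices img) auto
    finally show ?thesis .
  qed
  then show ?thesis by (rule polynomialsI)
qed

lemma multilinear_diagonal_polynomial:
  "(\<lambda>x. multilinear n r (replicate d x) F) \<in> polynomials n d"
proof (induction d arbitrary: F)
  case 0
  then show ?case by (simp add: polynomials_const)
next
  case (Suc d)
  have "(\<lambda>x. (1 / r) * (x i * multilinear n r (replicate d x) (\<lambda>zs. F (spike r i # zs))))
      \<in> polynomials n (Suc d)" if "i < n" for i
    by (intro polynomials_cmult polynomials_coord_mult Suc that)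
  from polynomials_sum[of "{..<n}", OF _ this] show ?case by simp
qed

section \<open>Approximation by polynomials\<close>

text \<open>
  Let \<open>m = Suc d\<close> and let \<open>F\<close> be the mixed difference of \<open>f\<close> of order \<open>m\<close> at \<open>0\<close>, which is almost
  additive in each slot. The function \<open>top x = F (x, \<dots>, x) / m!\<close> plays the role of the part of \<open>f\<close> of
  degree \<open>m\<close> and has two properties. It is within \<open>O(K * (k + 1))\<close> of a homogeneous polynomial,
  because \<open>F\<close> is near a multilinear function. And \<open>f - top\<close> satisfies the hypothesis of order \<open>m\<close>
  with a constant \<open>O(K)\<close> free of \<open>k\<close>: since \<open>top x\<close> is an alternating sum of the \<open>f (j x)\<close>,
  its mixed difference is an alternating sum of \<open>F (j h\<^sub>1, \<dots>, j h\<^sub>m) = j\<^sup>m F (h\<^sub>1, \<dots>, h\<^sub>m) + O(K)\<close>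
  divided by \<open>m!\<close>, and the alternating sum of the \<open>j\<^sup>m\<close> is \<open>m!\<close>. So the logarithmic
  factor is never fed back into the induction. The radius shrinks because the points \<open>j h\<close> have to
  stay in the ball.
\<close>

lemma almost_polynomial_near_polynomial:
  "\<exists>C s. 0 \<le> C \<and> 0 < s \<and> s \<le> 1 \<and>
     (\<forall>n k r K M f. n \<le> 2 ^ k \<longrightarrow> 0 < r \<longrightarrow> (\<forall>x. \<bar>f x\<bar> \<le> M) \<longrightarrow> almost_polynomial n (Suc d) r K f \<longrightarrow>
        (\<exists>\<phi>\<in>polynomials n d. \<forall>x\<in>l1_ball n (s * r). \<bar>f x - \<phi> x\<bar> \<le> C * K * (real k + 1)))"
proof (induction d)
  case 0
  show ?case
  proof (intro exI[of _ 1] conjI allI impI)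
    fix n k :: nat and r K M :: real and f :: "vec \<Rightarrow> real"
    assume a: "n \<le> 2 ^ k" "0 < r" "\<forall>x. \<bar>f x\<bar> \<le> M" "almost_polynomial n (Suc 0) r K f"
    have fx: "\<bar>f x - f 0\<bar> \<le> K" if "x \<in> l1_ball n r" for x
      using a(4)[unfolded almost_polynomial_def, rule_format, of "[x]"] that by simp
    have "0 \<le> K" using fx[of 0] a(2) by (simp add: zero_in_l1_ball)
    then have "K \<le> 1 * K * (real k + 1)" by (simp add: mult_left_le algebra_simps)
    then have "\<forall>x\<in>l1_ball n (1 * r). \<bar>f x - f 0\<bar> \<le> 1 * K * (real k + 1)"
      using fx order_trans by simp blast
    then show "\<exists>\<phi>\<in>polynomials n 0. \<forall>x\<in>l1_ball n (1 * r). \<bar>f x - \<phi> x\<bar> \<le> 1 * K * (real k + 1)"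
      by (intro bexI[of _ "\<lambda>_. f 0"] polynomials_const)
  qed auto
next
  case (Suc d)
  define m where "m = Suc d"
  obtain C s where C: "0 \<le> C" "0 < s" "s \<le> 1"
    and IH: "\<And>n k r K M f. n \<le> 2 ^ k \<Longrightarrow> 0 < r \<Longrightarrow> (\<And>x. \<bar>f x\<bar> \<le> M) \<Longrightarrow> almost_polynomial n m r K f \<Longrightarrow>
        (\<exists>\<phi>\<in>polynomials n d. \<forall>x\<in>l1_ball n (s * r). \<bar>f x - \<phi> x\<bar> \<le> C * K * (real k + 1))"
    using Suc.IH unfolding m_def by metis
  define A where "A = 2 ^ m * (real m * (real m + 1) ^ m) / fact m"
  define D where "D = real m * 11 / fact m"
  have A: "0 \<le> A" "0 \<le> D" by (auto simp: A_def D_def)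
  show ?case unfolding m_def[symmetric]
  proof (rule exI[of _ "C * A + D"], rule exI[of _ "s / real m"], intro conjI allI impI)
    show "0 \<le> C * A + D" using C A by simp
    show "0 < s / real m" using C by (simp add: m_def)
    show sm: "s / real m \<le> 1" using C by (simp add: m_def field_simps)
    fix n k :: nat and r K M :: real and f :: "vec \<Rightarrow> real"
    assume k: "n \<le> 2 ^ k" and r: "0 < r" and M: "\<forall>x. \<bar>f x\<bar> \<le> M" and f: "almost_polynomial n (Suc m) r K f"
    define F where "F hs = mixed_diff hs f 0" for hs
    have F: "almost_multiadditive n r K m F"
      unfolding F_def by (rule almost_multiadditive_mixed_diff[OF f])
    define top where "top x = F (replicate m x) / fact m" for x
    define g where "g x = f x - top x" for x
    have zero: "0 \<in> l1_ball n r" using r by (simp add: zero_in_l1_ball)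
    have K: "0 \<le> K"
      using almost_multiadditive_hd[of n r K "replicate d 0" F 0 0] F zero
      by (cases "d = 0") (auto simp: m_def)
    have F_bound: "\<bar>F hs\<bar> \<le> 2 ^ length hs * M" for hs
      unfolding F_def by (rule abs_mixed_diff_le) (use M in auto)
    have top_altsum: "top = (\<lambda>x. altsum m (\<lambda>j. f (scale (real j) x)) / fact m)"
      by (simp add: top_def F_def mixed_diff_replicate fun_eq_iff)
    have "almost_polynomial n m (r / real m) (A * K) g"
      unfolding almost_polynomial_def
    proof (intro allI impI)
      fix hs assume hs: "length hs = m" "set hs \<subseteq> l1_ball n (r / real m)"
      define B where "B = real m * (real m + 1) ^ m * K"
      have F_scale: "\<bar>F (map (scale (real j)) hs) - real j ^ m * F hs\<bar> \<le> B" if "j \<le> m" for j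
      proof -
        have "real j / real m \<le> 1" "1 / real m \<le> 1" using that by (auto simp: m_def)
        then have "real j / real m * r \<le> 1 * r" "1 / real m * r \<le> 1 * r"
          using r by (intro mult_right_mono; simp)+
        then have "\<bar>F (map (scale (real j)) hs) - real j ^ length hs * F hs\<bar>
            \<le> real (length hs) * (real j + 1) ^ length hs * K"
          using r hs F by (intro almost_multiadditive_scale[where s = "r / real m" and r = r]) auto
        also have "\<dots> \<le> B" unfolding B_def hs(1)
          using that K by (intro mult_right_mono mult_left_mono power_mono) auto
        finally show ?thesis by (simp add: hs)
      qed
      have "fact m * mixed_diff hs g 0 =
          altsum m (\<lambda>j. real j ^ m) * F hs - altsum m (\<lambda>j. F (map (scale (real j)) hs))"
        by (simp add: g_def[abs_def] mixed_diff_diff top_altsum mixed_diff_divide mixed_diff_altsum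
            mixed_diff_dilation F_def altsum_power right_diff_distrib)
      also have "\<dots> = - altsum m (\<lambda>j. F (map (scale (real j)) hs) - real j ^ m * F hs)"
        by (simp add: altsum_diff altsum_mult_right)
      finally have "\<bar>fact m * mixed_diff hs g 0\<bar> \<le> 2 ^ m * B"
        using abs_altsum_le[OF F_scale] by simp
      then have "fact m * \<bar>mixed_diff hs g 0\<bar> \<le> 2 ^ m * B"
        by (simp add: abs_mult)
      then show "\<bar>mixed_diff hs g 0\<bar> \<le> A * K"
        by (simp add: A_def B_def field_simps)
    qed
    moreover have "\<bar>g x\<bar> \<le> M + 2 ^ m * M / fact m" for x
    proof -
      have "\<bar>top x\<bar> \<le> 2 ^ m * M / fact m"
        using F_bound[of "replicate m x"] by (simp add: top_def divide_right_mono)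
      then show ?thesis using M[rule_format, of x] unfolding g_def by linarith
    qed
    ultimately obtain \<psi> where \<psi>: "\<psi> \<in> polynomials n d"
      "\<And>x. x \<in> l1_ball n (s * (r / real m)) \<Longrightarrow> \<bar>g x - \<psi> x\<bar> \<le> C * (A * K) * (real k + 1)"
      using IH[of n k "r / real m" g] k r by (metis divide_pos_pos m_def of_nat_0_less_iff zero_less_Suc)
    define \<tau> where "\<tau> x = (1 / fact m) * multilinear n r (replicate m x) F" for x
    have \<tau>: "\<tau> \<in> polynomials n m" unfolding \<tau>_def[abs_def]
      by (intro polynomials_cmult multilinear_diagonal_polynomial)
    have top: "\<bar>top x - \<tau> x\<bar> \<le> D * K * (real k + 1)" if x: "x \<in> l1_ball n r" for x
    proof -
      have "\<bar>F (replicate m x) - multilinear n r (replicate m x) F\<bar>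
          \<le> real (length (replicate m x)) * (11 * K * (real k + 1))"
      proof (rule almost_multiadditive_near_multilinear)
        show "\<bar>F zs\<bar> \<le> 2 ^ m * M" if "length zs = length (replicate m x)" for zs
          using F_bound[of zs] that by simp
      qed (use F x r k in auto)
      then show ?thesis
        by (simp add: top_def \<tau>_def D_def diff_divide_distrib[symmetric] divide_right_mono field_simps)
    qed
    show "\<exists>\<phi>\<in>polynomials n m. \<forall>x\<in>l1_ball n (s / real m * r).
        \<bar>f x - \<phi> x\<bar> \<le> (C * A + D) * K * (real k + 1)"
    proof (intro bexI[of _ "\<lambda>x. \<psi> x + \<tau> x"] ballI)
      show "(\<lambda>x. \<psi> x + \<tau> x) \<in> polynomials n m"
        using polynomials_mono[OF \<psi>(1), of m] \<tau> by (intro polynomials_add) (auto simp: m_def)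
      fix x assume x: "x \<in> l1_ball n (s / real m * r)"
      have "s / real m * r \<le> 1 * r" using sm r by (intro mult_right_mono) auto
      then have "\<bar>top x - \<tau> x\<bar> \<le> D * K * (real k + 1)"
        using x by (intro top) (auto elim: l1_ball_mono)
      moreover have "\<bar>g x - \<psi> x\<bar> \<le> C * (A * K) * (real k + 1)"
        using \<psi>(2)[of x] x by simp
      ultimately show "\<bar>f x - (\<psi> x + \<tau> x)\<bar> \<le> (C * A + D) * K * (real k + 1)"
        by (simp add: g_def algebra_simps abs_le_iff)
    qed
  qed
qed

lemma compact_l1_ball: "compact (l1_ball n r)"
proof -
  define S where "S i = (if i < n then {-r..r} else {0})" for i :: nat
  have "compactin (product_topology (\<lambda>i. euclidean) UNIV) (PiE UNIV S)"
    unfolding compactin_PiE by (auto simp: S_def)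
  then have cpt: "compact (PiE UNIV S)"
    by (simp add: euclidean_product_topology)
  have "closed {x :: vec. \<forall>i. i \<ge> n \<longrightarrow> x i = 0}"
    by (intro closed_Collect_all closed_Collect_imp open_Collect_const closed_Collect_eq
        continuous_on_coordinatewise_then_product continuous_intros continuous_on_product_coordinates)
  moreover have "closed {x :: vec. (\<Sum>i<n. \<bar>x i\<bar>) \<le> r}"
    by (intro closed_Collect_le continuous_intros continuous_on_product_coordinates)
  moreover have "l1_ball n r = PiE UNIV S \<inter> ({x. \<forall>i. i \<ge> n \<longrightarrow> x i = 0} \<inter> {x. (\<Sum>i<n. \<bar>x i\<bar>) \<le> r})"
  proof -
    have "\<bar>x i\<bar> \<le> r" if "(\<Sum>i<n. \<bar>x i\<bar>) \<le> r" "i < n" for x :: vec and i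
      using member_le_sum[of i "{..<n}" "\<lambda>i. \<bar>x i\<bar>"] that by simp
    then show ?thesis by (auto simp: l1_ball_def Rn_def l1_norm_def S_def abs_le_iff minus_le_iff)
  qed
  ultimately show ?thesis using cpt by (simp add: compact_Int_closed closed_Int)
qed

lemma monomial_scale:
  "(\<Prod>i<n. scale c x i ^ \<alpha> i) = c ^ (\<Sum>i<n. \<alpha> i) * (\<Prod>i<n. x i ^ \<alpha> i)"
  unfolding scale_apply by (simp add: power_mult_distrib prod.distrib power_sum)

lemma altsum_polynomial:
  assumes "\<phi> \<in> polynomials n d" "d < m"
  shows "altsum m (\<lambda>j. \<phi> (scale (real j) x)) = 0"
proof -
  obtain c where c: "\<phi> = (\<lambda>x. \<Sum>\<alpha>\<in>multi_indices n d. c \<alpha> * (\<Prod>i<n. x i ^ \<alpha> i))"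
    using assms unfolding polynomials_def by auto
  have "altsum m (\<lambda>j. \<phi> (scale (real j) x)) = (\<Sum>\<alpha>\<in>multi_indices n d.
      altsum m (\<lambda>j. real j ^ (\<Sum>i<n. \<alpha> i) * (c \<alpha> * (\<Prod>i<n. x i ^ \<alpha> i))))"
    unfolding c altsum_sum[symmetric] monomial_scale by (simp add: mult.left_commute)
  also have "\<dots> = 0"
    unfolding altsum_mult_right using assms(2)
    by (intro sum.neutral) (auto simp: multi_indices_def altsum_power)
  finally show ?thesis .
qed

text \<open>
  On the segment from \<open>0\<close> to \<open>x\<close> the \<open>m\<close>-th difference with step \<open>x / m\<close> expresses \<open>g x\<close> by the
  values of \<open>g\<close> at points whose norm is smaller by the factor \<open>1 - 1 / m\<close> at least.
\<close>

lemma bound_extends_to_unit_ball: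
  assumes m: "0 < m"
    and diff: "\<And>x. x \<in> l1_ball n 1 \<Longrightarrow> \<bar>altsum m (\<lambda>j. g (scale (real j / real m) x))\<bar> \<le> 1"
    and T: "1 \<le> T" "\<And>x. x \<in> l1_ball n ((1 - 1 / real m) ^ p) \<Longrightarrow> \<bar>g x\<bar> \<le> T"
    and x: "x \<in> l1_ball n 1"
  shows "\<bar>g x\<bar> \<le> (1 + 2 ^ m) ^ p * T"
  using T
proof (induction p arbitrary: T)
  case 0
  then show ?case using x by simp
next
  case (Suc p)
  define q where "q = 1 - 1 / real m"
  have q: "0 \<le> q" "q \<le> 1" using m by (auto simp: q_def)
  have "\<bar>g x\<bar> \<le> (1 + 2 ^ m) ^ p * ((1 + 2 ^ m) * T)"
  proof (rule Suc.IH)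
    show "1 \<le> (1 + 2 ^ m) * T"
      using mult_mono[of 1 "1 + 2 ^ m" 1 T] Suc.prems(1) by simp
    fix y assume "y \<in> l1_ball n ((1 - 1 / real m) ^ p)"
    then have y: "y \<in> l1_ball n (q ^ p)" by (simp add: q_def)
    define a where "a j = g (scale (real j / real m) y)" for j
    (* The sequence b keeps only the term j = m, whose coefficient in altsum m is 1. *)
    define b where "b j = (if j = m then 1 else 0) * g y" for j
    have "\<bar>a j - b j\<bar> \<le> T" if "j \<le> m" for j
    proof (cases "j = m")
      case True
      then show ?thesis using m Suc.prems(1) by (simp add: a_def b_def)
    next
      case False
      then have "real j / real m \<le> q" using that m by (simp add: q_def field_simps)
      then have "real j / real m * q ^ p \<le> q ^ Suc p"
        using q mult_right_mono[of "real j / real m" q "q ^ p"] by simp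
      then have "scale (real j / real m) y \<in> l1_ball n (q ^ Suc p)"
        by (intro l1_ball_scale[OF y]) simp
      then show ?thesis using Suc.prems(2) False unfolding q_def a_def b_def by simp
    qed
    from abs_altsum_le[OF this] have "\<bar>altsum m a - altsum m b\<bar> \<le> 2 ^ m * T"
      by (simp add: altsum_diff)
    moreover have "altsum m b = g y"
      unfolding b_def altsum_mult_right by (simp add: altsum_def if_distrib[of "(*) _"] cong: if_cong)
    moreover have "\<bar>altsum m a\<bar> \<le> 1"
      unfolding a_def using q y by (intro diff) (auto elim!: l1_ball_mono intro: power_le_one)
    ultimately show "\<bar>g y\<bar> \<le> (1 + 2 ^ m) * T"
      using Suc.prems(1) by (simp add: algebra_simps abs_le_iff)
  qed
  then show ?case by (simp add: mult.assoc mult.left_commute)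
qed

lemma smoothness_modulus_le_iff:
  "smoothness_modulus m n (l1_norm n) f \<le> ereal B \<longleftrightarrow>
    (\<forall>x h. x \<in> Rn n \<longrightarrow> h \<in> Rn n \<longrightarrow> (\<forall>j\<le>m. x + scale (real j) h \<in> l1_ball n 1) \<longrightarrow>
        \<bar>altsum m (\<lambda>j. f (x + scale (real j) h))\<bar> \<le> B)"
  by (auto simp: smoothness_modulus_def SUP_le_iff fin_diff_altsum unit_ball_l1 plus_fun_def scale_def)

text \<open>
  Outside the unit ball \<open>f\<close> is replaced by \<open>0\<close> to have a function that is bounded everywhere; this
  does not affect the differences at points of the ball. The approximation found on a small
  ball extends to the unit ball because a polynomial of degree less than \<open>m\<close> does not change
  \<open>m\<close>-th differences.
\<close>

lemma near_polynomial_of_degree_less: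
  assumes m: "0 < m"
  shows "\<exists>C\<ge>0. \<forall>n k f. n \<le> 2 ^ k \<longrightarrow> continuous_on (l1_ball n 1) f \<longrightarrow>
    smoothness_modulus m n (l1_norm n) f \<le> 1 \<longrightarrow>
    (\<exists>\<phi>\<in>polynomials n (m - 1). \<forall>x\<in>l1_ball n 1. \<bar>f x - \<phi> x\<bar> \<le> C * (real k + 1))"
proof -
  define d where "d = m - 1"
  have md: "m = Suc d" using m by (simp add: d_def)
  obtain C s where C: "0 \<le> C" "0 < s" "s \<le> 1"
    and approx: "\<And>n k r K M f. n \<le> 2 ^ k \<Longrightarrow> 0 < r \<Longrightarrow> (\<And>x. \<bar>f x\<bar> \<le> M) \<Longrightarrow> almost_polynomial n m r K f \<Longrightarrow>
        (\<exists>\<phi>\<in>polynomials n d. \<forall>x\<in>l1_ball n (s * r). \<bar>f x - \<phi> x\<bar> \<le> C * K * (real k + 1))"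
    using almost_polynomial_near_polynomial[of d] unfolding md by metis
  define r where "r = 1 / real m ^ 2"
  have r: "0 < r" using m by (simp add: r_def)
  have "1 - 1 / real m < 1" using m by simp
  then obtain p where p: "(1 - 1 / real m) ^ p < s * r"
    using real_arch_pow_inv[of "s * r" "1 - 1 / real m"] C r by auto
  define E where "E = (1 + 2 ^ m) ^ p * (C * 2 ^ m + 1)"
  show ?thesis
  proof (intro exI[of _ E] conjI allI impI)
    show "0 \<le> E" using C by (simp add: E_def)
    fix n k :: nat and f :: "vec \<Rightarrow> real"
    assume k: "n \<le> 2 ^ k" and cont: "continuous_on (l1_ball n 1) f"
      and modulus: "smoothness_modulus m n (l1_norm n) f \<le> 1"
    define f0 where "f0 x = (if x \<in> l1_ball n 1 then f x else 0)" for x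
    obtain M where M: "0 \<le> M" "\<And>x. x \<in> l1_ball n 1 \<Longrightarrow> \<bar>f x\<bar> \<le> M"
      using compact_imp_bounded[OF compact_continuous_image[OF cont compact_l1_ball]]
      unfolding bounded_pos by (auto intro: less_imp_le)
    have diff0: "\<bar>altsum m (\<lambda>j. f0 (x + scale (real j) h))\<bar> \<le> 1"
      if "x \<in> Rn n" "h \<in> Rn n" "\<And>j. j \<le> m \<Longrightarrow> x + scale (real j) h \<in> l1_ball n 1" for x h
    proof -
      have "altsum m (\<lambda>j. f0 (x + scale (real j) h)) = altsum m (\<lambda>j. f (x + scale (real j) h))"
        by (intro altsum_cong) (simp add: f0_def that)
      then show ?thesis
        using modulus that unfolding one_ereal_def smoothness_modulus_le_iff by simp
    qed
    have "almost_polynomial n m r (2 ^ m) f0"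
      unfolding r_def by (rule almost_polynomial_if_differences_bounded[OF diff0 m])
    moreover have "\<bar>f0 x\<bar> \<le> M" for x using M by (simp add: f0_def)
    ultimately obtain \<phi> where \<phi>: "\<phi> \<in> polynomials n d"
      "\<And>x. x \<in> l1_ball n (s * r) \<Longrightarrow> \<bar>f0 x - \<phi> x\<bar> \<le> C * 2 ^ m * (real k + 1)"
      using approx[OF k r] by metis
    define T where "T = (C * 2 ^ m + 1) * (real k + 1)"
    have T: "1 \<le> T" "C * 2 ^ m * (real k + 1) \<le> T"
      using C(1) by (auto simp: T_def algebra_simps)
    show "\<exists>\<phi>\<in>polynomials n (m - 1). \<forall>x\<in>l1_ball n 1. \<bar>f x - \<phi> x\<bar> \<le> E * (real k + 1)"
    proof (intro bexI[of _ \<phi>] ballI)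
      show "\<phi> \<in> polynomials n (m - 1)" using \<phi>(1) by (simp add: d_def)
      fix x assume x: "x \<in> l1_ball n 1"
      have "\<bar>f0 x - \<phi> x\<bar> \<le> (1 + 2 ^ m) ^ p * T"
      proof (rule bound_extends_to_unit_ball[where g = "\<lambda>x. f0 x - \<phi> x", OF m _ T(1) _ x])
        show "\<bar>f0 y - \<phi> y\<bar> \<le> T" if "y \<in> l1_ball n ((1 - 1 / real m) ^ p)" for y
          using \<phi>(2)[of y] l1_ball_mono[OF that, of "s * r"] p T(2) by linarith
        fix y assume y: "y \<in> l1_ball n 1"
        define h where "h = scale (1 / real m) y"
        have ray: "scale (real j) h = scale (real j / real m) y" for j by (simp add: h_def)
        have "\<bar>altsum m (\<lambda>j. f0 (0 + scale (real j) h))\<bar> \<le> 1"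
        proof (rule diff0)
          show "h \<in> Rn n" using y by (simp add: h_def l1_ball_def Rn_closed)
          show "0 + scale (real j) h \<in> l1_ball n 1" if "j \<le> m" for j
            unfolding ray add_0 using that m by (intro l1_ball_scale[OF y]) simp
        qed (simp add: Rn_closed)
        moreover have "altsum m (\<lambda>j. \<phi> (scale (real j) h)) = 0"
          using altsum_polynomial[OF \<phi>(1)] by (simp add: md)
        ultimately show "\<bar>altsum m (\<lambda>j. f0 (scale (real j / real m) y) - \<phi> (scale (real j / real m) y))\<bar> \<le> 1"
          unfolding ray[symmetric] altsum_diff by simp
      qed
      then show "\<bar>f x - \<phi> x\<bar> \<le> E * (real k + 1)"
        using x by (simp add: f0_def E_def T_def mult.assoc)
    qed
  qed
qed

section \<open>The entropy function is far from polynomials\<close>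

definition xlnx :: "real \<Rightarrow> real" where
  "xlnx t = t * ln \<bar>t\<bar>"

lemma xlnx_simps [simp]: "xlnx 0 = 0" "xlnx 1 = 0" "xlnx (- t) = - xlnx t"
  by (auto simp: xlnx_def)

text \<open>
  Because \<open>ln 0 = 0\<close>, this includes the cases \<open>c = 0\<close> and \<open>t = 0\<close>.
\<close>

lemma xlnx_mult: "xlnx (c * t) = c * xlnx t + xlnx c * t"
  by (cases "c = 0 \<or> t = 0") (auto simp: xlnx_def abs_mult ln_mult algebra_simps)

lemma abs_xlnx_le_1:
  assumes "0 \<le> t" "t \<le> 1"
  shows "\<bar>xlnx t\<bar> \<le> 1"
proof (cases "t = 0")
  case False
  then have t: "0 < t" using assms by simp
  have "t * ln (1 / t) \<le> t * (1 / t - 1)"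
    using t by (intro mult_left_mono ln_le_minus_one) auto
  moreover have "ln (1 / t) = - ln t" using t by (simp add: ln_div)
  moreover have "t * ln t \<le> 0"
    using t assms by (intro mult_nonneg_nonpos) auto
  ultimately show ?thesis using t by (simp add: xlnx_def abs_le_iff algebra_simps)
qed simp

lemma continuous_xlnx: "continuous_on UNIV xlnx"
proof (rule continuous_at_imp_continuous_on, rule ballI)
  fix t :: real
  show "isCont xlnx t"
  proof (cases "t = 0")
    case False
    then show ?thesis unfolding xlnx_def by (intro continuous_intros) auto
  next
    case True
    (* Squaring in the product rule: u ln u = 2 (sqrt u) (sqrt u ln (sqrt u)), and the last
       factor is bounded. *)
    have bound: "\<bar>xlnx u\<bar> \<le> 2 * sqrt \<bar>u\<bar>" if "\<bar>u\<bar> \<le> 1" for u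
    proof -
      have "xlnx \<bar>u\<bar> = 2 * sqrt \<bar>u\<bar> * xlnx (sqrt \<bar>u\<bar>)"
        using xlnx_mult[of "sqrt \<bar>u\<bar>" "sqrt \<bar>u\<bar>"] by simp
      moreover have "\<bar>xlnx (sqrt \<bar>u\<bar>)\<bar> \<le> 1"
        using that by (intro abs_xlnx_le_1) auto
      ultimately have "\<bar>xlnx \<bar>u\<bar>\<bar> \<le> 2 * sqrt \<bar>u\<bar>"
        by (simp add: abs_mult mult_left_le)
      then show ?thesis by (simp add: xlnx_def abs_mult)
    qed
    have "(xlnx \<longlongrightarrow> 0) (at 0)"
    proof (rule Lim_null_comparison)
      show "\<forall>\<^sub>F u in at 0. norm (xlnx u) \<le> 2 * sqrt \<bar>u\<bar>"
        using bound by (auto simp: eventually_at dist_real_def intro!: exI[of _ 1])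
      show "((\<lambda>u. 2 * sqrt \<bar>u\<bar>) \<longlongrightarrow> 0) (at 0)"
        by (auto intro!: tendsto_eq_intros)
    qed
    then show ?thesis using True by (simp add: isCont_def)
  qed
qed

text \<open>
  By oddness let \<open>u \<ge> 0\<close>. For \<open>u \<le> 1\<close> all values involved are at most \<open>2\<close>; for \<open>u > 1\<close> the logarithms
  of \<open>u\<close> combine to \<open>(u + 1) ln (1 + 1/u) + (u - 1) ln (1 - 1/u)\<close>, and both terms are bounded by
  \<open>ln t \<le> t - 1\<close>.
\<close>

lemma abs_unit_second_diff_xlnx_le: "\<bar>xlnx (u + 1) - 2 * xlnx u + xlnx (u - 1)\<bar> \<le> 8"
proof -
  have pos: "\<bar>xlnx (u + 1) - 2 * xlnx u + xlnx (u - 1)\<bar> \<le> 8" if u: "0 \<le> u" for u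
  proof (cases "u \<le> 1")
    case True
    have small: "\<bar>xlnx t\<bar> \<le> 2" if "0 \<le> t" "t \<le> 2" for t
    proof (cases "t \<le> 1")
      case True
      then show ?thesis using abs_xlnx_le_1[of t] that by simp
    next
      case False
      have "ln t \<le> t - 1" using False by (intro ln_le_minus_one) simp
      then have "t * ln t \<le> 2 * 1" using that False by (intro mult_mono) auto
      then show ?thesis using False by (simp add: xlnx_def)
    qed
    have "xlnx (u - 1) = - xlnx (1 - u)" using xlnx_simps(3)[of "1 - u"] by simp
    then show ?thesis using small[of "u + 1"] small[of u] small[of "1 - u"] u True by (simp add: abs_le_iff)
  next
    case False
    have a: "0 \<le> (u + 1) * ln ((u + 1) / u)" using False by (intro mult_nonneg_nonneg) auto
    have "(u + 1) * ln ((u + 1) / u) \<le> (u + 1) * ((u + 1) / u - 1)"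
      using False by (intro mult_left_mono ln_le_minus_one) auto
    also have "\<dots> \<le> 2" using False by (simp add: field_simps)
    finally have b: "(u + 1) * ln ((u + 1) / u) \<le> 2" .
    have c: "0 \<le> (u - 1) * ln (u / (u - 1))" using False by (intro mult_nonneg_nonneg) auto
    have "(u - 1) * ln (u / (u - 1)) \<le> (u - 1) * (u / (u - 1) - 1)"
      using False by (intro mult_left_mono ln_le_minus_one) auto
    also have "\<dots> = 1" using False by (simp add: field_simps)
    finally have d: "(u - 1) * ln (u / (u - 1)) \<le> 1" .
    have "xlnx (u + 1) - 2 * xlnx u + xlnx (u - 1) = (u + 1) * ln ((u + 1) / u) - (u - 1) * ln (u / (u - 1))"
      using False by (simp add: xlnx_def ln_div algebra_simps)
    then show ?thesis using a b c d by (simp add: abs_le_iff)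
  qed
  show ?thesis
  proof (cases "0 \<le> u")
    case False
    have neg: "- u - 1 = - (u + 1)" "- u + 1 = - (u - 1)" by simp_all
    have "xlnx (u + 1) = - xlnx (- u - 1)" "xlnx (u - 1) = - xlnx (- u + 1)"
      unfolding neg xlnx_simps by simp_all
    then show ?thesis using pos[of "- u"] False by (simp add: abs_le_iff)
  qed (rule pos)
qed

text \<open>
  The term linear in \<open>t\<close> in the product rule for \<open>xlnx\<close> disappears in second differences, so these
  are homogeneous and the step can be normalised to \<open>1\<close>.
\<close>

lemma abs_second_diff_xlnx_le: "\<bar>xlnx (s + 2 * h) - 2 * xlnx (s + h) + xlnx s\<bar> \<le> 8 * \<bar>h\<bar>"
proof (cases "h = 0")
  case False
  (* s, s + h, s + 2 h become h (u - 1), h u, h (u + 1). *)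
  define u where "u = s / h + 1"
  have s: "s + 2 * h = h * (u + 1)" "s + h = h * u" "s = h * (u - 1)"
    using False by (auto simp: u_def field_simps)
  have "xlnx (s + 2 * h) - 2 * xlnx (s + h) + xlnx s = h * (xlnx (u + 1) - 2 * xlnx u + xlnx (u - 1))"
    unfolding s(1,2) by (subst s(3)) (simp only: xlnx_mult, simp add: algebra_simps)
  then show ?thesis
    using mult_left_mono[OF abs_unit_second_diff_xlnx_le, of "\<bar>h\<bar>" u] by (simp add: abs_mult mult.commute)
qed simp

lemma abs_altsum_xlnx_le:
  assumes "2 \<le> m"
  shows "\<bar>altsum m (\<lambda>j. xlnx (s + real j * h))\<bar> \<le> 2 ^ (m + 1) * \<bar>h\<bar>"
proof -
  obtain d where m: "m = Suc (Suc d)" using assms by (metis add_2_eq_Suc le_Suc_ex)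
  have "altsum m (\<lambda>j. xlnx (s + real j * h)) = altsum d (\<lambda>j.
      xlnx ((s + real j * h) + 2 * h) - 2 * xlnx ((s + real j * h) + h) + xlnx (s + real j * h))"
    unfolding m altsum_Suc by (simp add: algebra_simps)
  also have "\<bar>\<dots>\<bar> \<le> 2 ^ d * (8 * \<bar>h\<bar>)"
    by (intro abs_altsum_le abs_second_diff_xlnx_le)
  finally show ?thesis by (simp add: m)
qed

text \<open>
  The negative of Shannon's entropy on probability vectors, extended oddly in each coordinate.
\<close>

definition entropy :: "nat \<Rightarrow> vec \<Rightarrow> real" where
  "entropy n x = (\<Sum>i<n. xlnx (x i))"

lemma continuous_entropy: "continuous_on S (entropy n)"
  unfolding entropy_def
  by (intro continuous_intros continuous_on_compose2[OF continuous_xlnx]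
      continuous_on_subset[OF continuous_on_product_coordinates]) auto

lemma entropy_scale: "entropy n (scale c x) = c * entropy n x + xlnx c * (\<Sum>i<n. x i)"
  by (simp add: entropy_def scale_apply xlnx_mult sum.distrib sum_distrib_left)

lemma abs_altsum_entropy_le:
  assumes m: "2 \<le> m" and ball: "x \<in> l1_ball n 1" "x + scale (real m) h \<in> l1_ball n 1"
  shows "\<bar>altsum m (\<lambda>j. entropy n (x + scale (real j) h))\<bar> \<le> 2 ^ (m + 1)"
proof -
  have "scale (real m) h = (x + scale (real m) h) + scale (-1) x"
    by (auto simp: scale_def plus_fun_def)
  also have "\<dots> \<in> l1_ball n (1 + 1)"
    by (intro l1_ball_add[OF ball(2)] l1_ball_scale[OF ball(1)]) simp
  finally have "real m * l1_norm n h \<le> 2" by (simp add: l1_ball_def)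
  moreover have "2 * l1_norm n h \<le> real m * l1_norm n h"
    using m by (intro mult_right_mono) auto
  ultimately have h: "l1_norm n h \<le> 1" by linarith
  have "altsum m (\<lambda>j. entropy n (x + scale (real j) h))
      = (\<Sum>i<n. altsum m (\<lambda>j. xlnx (x i + real j * h i)))"
    unfolding entropy_def altsum_sum by (simp add: plus_fun_def scale_def)
  also have "\<bar>\<dots>\<bar> \<le> (\<Sum>i<n. 2 ^ (m + 1) * \<bar>h i\<bar>)"
    by (rule order_trans[OF sum_abs], intro sum_mono abs_altsum_xlnx_le m)
  also have "\<dots> = 2 ^ (m + 1) * l1_norm n h"
    by (simp add: l1_norm_def sum_distrib_left)
  also have "\<dots> \<le> 2 ^ (m + 1) * 1"
    using h by (intro mult_left_mono) auto
  finally show ?thesis by simp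
qed

text \<open>
  The weights are the coefficients of the Lagrange polynomial that is \<open>1\<close> at \<open>1/2\<close> and \<open>0\<close> at the
  other points \<open>(1/2)\<^sup>d\<close>. The functional \<open>g \<mapsto> (\<Sum>j\<le>N. w j * g (x / 2\<^sup>j))\<close> then maps a polynomial of
  degree less than \<open>m\<close> to its homogeneous part of degree one.
\<close>

lemma weights_extracting_linear_part:
  "\<exists>w N. \<forall>d<m. (\<Sum>j\<le>N. w j * ((1 / 2) ^ j) ^ d) = (if d = 1 then 1 else 0 :: real)"
proof -
  (* (1/2)^j to the power d is (1/2)^d to the power j, so the sum in question is a value of a
     polynomial with coefficients w j. *)
  define Q :: "real poly" where "Q = (\<Prod>d\<in>{..<m} - {1}. [:- ((1 / 2) ^ d), 1:])"
  define c where "c = poly Q (1 / 2)"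
  have Q: "poly Q z = (\<Prod>d\<in>{..<m} - {1}. z - (1 / 2) ^ d)" for z
    by (simp add: Q_def poly_prod)
  have "(1 / 2 :: real) \<noteq> (1 / 2) ^ d" if "d \<noteq> 1" for d
    using that power_inject_exp'[of "1 / 2 :: real" 1 d] by simp
  then have c: "c \<noteq> 0" by (simp add: c_def Q)
  have "(\<Sum>j\<le>degree Q. coeff Q j / c * ((1 / 2) ^ j) ^ d) = (if d = 1 then 1 else 0)" if "d < m" for d
  proof -
    have "(\<Sum>j\<le>degree Q. coeff Q j / c * ((1 / 2) ^ j) ^ d) = poly Q ((1 / 2) ^ d) / c"
      by (simp add: poly_altdef sum_divide_distrib power_mult[symmetric] mult.commute)
    also have "\<dots> = (if d = 1 then 1 else 0)"
      using that c by (auto simp: c_def Q)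
    finally show ?thesis .
  qed
  then show ?thesis by (intro exI allI impI)
qed

lemma monomial_of_degree_one:
  assumes "(\<Sum>i<n. \<alpha> i) = (1::nat)"
  obtains i where "i < n" "\<And>x :: vec. (\<Prod>l<n. x l ^ \<alpha> l) = x i"
proof -
  obtain i where i: "i < n" "\<alpha> i = 1" "\<And>l. l < n \<Longrightarrow> l \<noteq> i \<Longrightarrow> \<alpha> l = 0"
    using assms unfolding sum_eq_1_iff[OF finite_lessThan] by auto
  have "(\<Prod>l<n. x l ^ \<alpha> l) = x i" for x :: vec
  proof -
    have "(\<Prod>l<n. x l ^ \<alpha> l) = (\<Prod>l<n. if l = i then x l else 1)"
      using i by (intro prod.cong) auto
    then show ?thesis using i(1) by simp
  qed
  then show thesis using that i(1) by blast
qed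

text \<open>
  Apply the functional \<open>L\<close> with these weights to \<open>entropy n - \<phi>\<close>. It turns \<open>\<phi>\<close> into a linear form and
  changes the entropy only by a linear form. Linear forms do not see the difference between
  \<open>y = (1/(2n), \<dots>, 1/(2n))\<close> and \<open>1/(2n)\<close> times the sum of the unit vectors \<open>spike 1 i\<close>, whereas
  the entropy is \<open>- ln (2 * n) / 2\<close> at \<open>y\<close> and \<open>0\<close> at each unit vector. The factor \<open>1/2\<close> in \<open>y\<close>
  keeps the bound positive in dimension one.
\<close>

lemma entropy_far_from_polynomials:
  assumes m: "2 \<le> m"
  shows "\<exists>W>0. \<forall>n \<phi> T. 1 \<le> n \<longrightarrow> \<phi> \<in> polynomials n (m - 1) \<longrightarrow>
     (\<forall>x\<in>l1_ball n 1. \<bar>entropy n x - \<phi> x\<bar> \<le> T) \<longrightarrow> ln (real n + 1) \<le> W * T"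
proof -
  obtain w :: "nat \<Rightarrow> real" and N
    where w: "\<And>d. d < m \<Longrightarrow> (\<Sum>j\<le>N. w j * ((1 / 2) ^ j) ^ d) = (if d = 1 then 1 else 0)"
    using weights_extracting_linear_part by metis
  define W where "W = (\<Sum>j\<le>N. \<bar>w j\<bar>)"
  define L where "L g x = (\<Sum>j\<le>N. w j * g (scale ((1 / 2) ^ j) x))" for g :: "vec \<Rightarrow> real" and x
  define \<kappa> where "\<kappa> = (\<Sum>j\<le>N. w j * xlnx ((1 / 2) ^ j))"
  have W: "0 \<le> W" by (simp add: W_def sum_nonneg)
  have L_entropy: "L (entropy n) x = entropy n x + \<kappa> * (\<Sum>i<n. x i)" for n x
  proof -
    have "L (entropy n) x = (\<Sum>j\<le>N. w j * ((1 / 2) ^ j) ^ 1) * entropy n x + \<kappa> * (\<Sum>i<n. x i)"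
      by (simp add: L_def entropy_scale \<kappa>_def distrib_left sum.distrib sum_distrib_right mult.assoc)
    then show ?thesis using w[of 1] m by simp
  qed
  show ?thesis
  proof (intro exI[of _ "3 * W + 1"] conjI allI impI)
    show "0 < 3 * W + 1" using W by simp
    fix n :: nat and \<phi> and T :: real
    assume n: "1 \<le> n" and \<phi>: "\<phi> \<in> polynomials n (m - 1)"
      and T: "\<forall>x\<in>l1_ball n 1. \<bar>entropy n x - \<phi> x\<bar> \<le> T"
    obtain c where c: "\<phi> = (\<lambda>x. \<Sum>\<alpha>\<in>multi_indices n (m - 1). c \<alpha> * (\<Prod>i<n. x i ^ \<alpha> i))"
      using \<phi> unfolding polynomials_def by auto
    define I where "I = {\<alpha> \<in> multi_indices n (m - 1). (\<Sum>i<n. \<alpha> i) = 1}"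
    have L_\<phi>: "L \<phi> x = (\<Sum>\<alpha>\<in>I. c \<alpha> * (\<Prod>i<n. x i ^ \<alpha> i))" for x
    proof -
      have "L \<phi> x = (\<Sum>\<alpha>\<in>multi_indices n (m - 1). \<Sum>j\<le>N.
          (w j * ((1 / 2) ^ j) ^ (\<Sum>i<n. \<alpha> i)) * (c \<alpha> * (\<Prod>i<n. x i ^ \<alpha> i)))"
        unfolding L_def c sum_distrib_left monomial_scale
        by (subst sum.swap) (simp add: mult_ac)
      also have "\<dots> = (\<Sum>\<alpha>\<in>multi_indices n (m - 1).
          (if (\<Sum>i<n. \<alpha> i) = 1 then 1 else 0) * (c \<alpha> * (\<Prod>i<n. x i ^ \<alpha> i)))"
        unfolding sum_distrib_right[symmetric] using m
        by (intro sum.cong arg_cong2[where f = "(*)"] w) (auto simp: multi_indices_def)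
      also have "\<dots> = (\<Sum>\<alpha>\<in>I. c \<alpha> * (\<Prod>i<n. x i ^ \<alpha> i))"
        unfolding I_def by (intro sum.mono_neutral_cong_right finite_multi_indices) auto
      finally show ?thesis .
    qed
    define G where "G x = L (entropy n) x - L \<phi> x" for x
    have T0: "0 \<le> T" using T zero_in_l1_ball[of 1 n] by force
    have G: "\<bar>G x\<bar> \<le> W * T" if x: "x \<in> l1_ball n 1" for x
    proof -
      have "G x = (\<Sum>j\<le>N. w j * (entropy n (scale ((1 / 2) ^ j) x) - \<phi> (scale ((1 / 2) ^ j) x)))"
        by (simp add: G_def L_def sum_subtractf right_diff_distrib)
      also have "\<bar>\<dots>\<bar> \<le> (\<Sum>j\<le>N. \<bar>w j\<bar> * T)"
      proof (rule order_trans[OF sum_abs], intro sum_mono)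
        fix j
        have "scale ((1 / 2) ^ j) x \<in> l1_ball n 1"
          by (intro l1_ball_scale[OF x]) (simp add: power_le_one)
        then show "\<bar>w j * (entropy n (scale ((1 / 2) ^ j) x) - \<phi> (scale ((1 / 2) ^ j) x))\<bar> \<le> \<bar>w j\<bar> * T"
          using T by (simp add: abs_mult mult_left_mono)
      qed
      finally show ?thesis by (simp add: W_def sum_distrib_right)
    qed
    define t where "t = 1 / (2 * real n)"
    define y where "y = (\<lambda>i. if i < n then t else 0)"
    have t: "0 < t" "real n * t = 1 / 2" using n by (auto simp: t_def)
    have y: "y \<in> l1_ball n 1"
      using t by (simp add: y_def l1_ball_def Rn_def l1_norm_def)
    have sp: "spike 1 i \<in> l1_ball n 1" if "i < n" for i
      using that by (simp add: spike_in_l1_ball)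
    have "L \<phi> y = t * (\<Sum>i<n. L \<phi> (spike 1 i))"
    proof -
      have mon: "(\<Prod>i<n. y i ^ \<alpha> i) = t * (\<Sum>i<n. \<Prod>l<n. spike 1 i l ^ \<alpha> l)" if "\<alpha> \<in> I" for \<alpha>
      proof -
        have "(\<Sum>i<n. \<alpha> i) = 1" using that by (simp add: I_def)
        then obtain i where i: "i < n" "\<And>x :: vec. (\<Prod>l<n. x l ^ \<alpha> l) = x i"
          by (rule monomial_of_degree_one) blast
        show ?thesis using i(1) unfolding i(2) by (simp add: y_def spike_def)
      qed
      have "L \<phi> y = (\<Sum>\<alpha>\<in>I. \<Sum>i<n. t * (c \<alpha> * (\<Prod>l<n. spike 1 i l ^ \<alpha> l)))"
        unfolding L_\<phi> by (intro sum.cong) (auto simp: mon sum_distrib_left mult_ac)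
      also have "\<dots> = t * (\<Sum>i<n. L \<phi> (spike 1 i))"
        unfolding L_\<phi> sum_distrib_left by (rule sum.swap)
      finally show ?thesis .
    qed
    moreover have "L (entropy n) y = real n * xlnx t + \<kappa> * (1 / 2)"
      using t by (simp add: L_entropy entropy_def y_def)
    moreover have "t * (\<Sum>i<n. L (entropy n) (spike 1 i)) = \<kappa> * (1 / 2)"
    proof -
      have "L (entropy n) (spike 1 i) = \<kappa>" if "i < n" for i
        using that by (simp add: L_entropy entropy_def spike_def if_distrib[of xlnx] cong: if_cong)
      then have "t * (\<Sum>i<n. L (entropy n) (spike 1 i)) = (real n * t) * \<kappa>" by simp
      then show ?thesis unfolding t(2) by simp
    qed
    ultimately have "G y - t * (\<Sum>i<n. G (spike 1 i)) = real n * xlnx t"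
      by (simp add: G_def sum_subtractf right_diff_distrib)
    moreover have "real n * xlnx t = - (ln (2 * real n) / 2)"
    proof -
      have "real n * xlnx t = (real n * t) * ln t" using t(1) by (simp add: xlnx_def)
      then show ?thesis unfolding t(2) using n by (simp add: t_def ln_div)
    qed
    moreover have "\<bar>t * (\<Sum>i<n. G (spike 1 i))\<bar> \<le> t * (real n * (W * T))"
    proof -
      have "\<bar>\<Sum>i<n. G (spike 1 i)\<bar> \<le> (\<Sum>i<n. W * T)"
        by (rule order_trans[OF sum_abs], intro sum_mono G sp) simp
      then show ?thesis using t by (simp add: abs_mult)
    qed
    moreover have "t * (real n * (W * T)) = W * T / 2"
    proof -
      have "t * (real n * (W * T)) = (real n * t) * (W * T)" by simp
      then show ?thesis unfolding t(2) by simp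
    qed
    ultimately have "ln (2 * real n) \<le> 3 * (W * T)"
      using G[OF y] by linarith
    moreover have "ln (real n + 1) \<le> ln (2 * real n)" using n by simp
    ultimately show "ln (real n + 1) \<le> (3 * W + 1) * T"
      using T0 by (simp add: distrib_right)
  qed
qed

section \<open>The Whitney constant of \<open>\<ell>\<^sub>1\<close>\<close>

theorem corollary5p7:
  fixes m :: nat
  assumes "m \<ge> 2"
  shows "\<exists>C :: real. C > 0 \<and>
    (\<forall>n::nat. n \<ge> 1 \<longrightarrow>
       ereal (inverse C * ln (real n + 1)) \<le> whitney_const m n (l1_norm n) \<and>
       whitney_const m n (l1_norm n) \<le> ereal (C * ln (real n + 1)))"
proof -
  obtain A where A: "0 \<le> A" and upper: "\<And>n k f. n \<le> 2 ^ k \<Longrightarrow> continuous_on (l1_ball n 1) f \<Longrightarrow>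
      smoothness_modulus m n (l1_norm n) f \<le> 1 \<Longrightarrow>
      \<exists>\<phi>\<in>polynomials n (m - 1). \<forall>x\<in>l1_ball n 1. \<bar>f x - \<phi> x\<bar> \<le> A * (real k + 1)"
    using near_polynomial_of_degree_less[of m] assms by auto
  obtain W where W: "0 < W" and lower: "\<And>n \<phi> T. 1 \<le> n \<Longrightarrow> \<phi> \<in> polynomials n (m - 1) \<Longrightarrow>
      (\<And>x. x \<in> l1_ball n 1 \<Longrightarrow> \<bar>entropy n x - \<phi> x\<bar> \<le> T) \<Longrightarrow> ln (real n + 1) \<le> W * T"
    using entropy_far_from_polynomials[OF assms] by metis
  define K :: real where "K = 2 ^ (m + 1)"
  define C where "C = 3 * A / ln 2 + W * K"
  have K: "0 < K" by (simp add: K_def)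
  have C: "0 < C" "W * K \<le> C" "3 * A / ln 2 \<le> C"
    using A W K by (auto simp: C_def intro: add_nonneg_pos)
  show ?thesis
  proof (intro exI[of _ C] conjI allI impI)
    show "0 < C" by (rule C)
    fix n :: nat assume n: "n \<ge> 1"
    have ln_pos: "ln 2 \<le> ln (real n + 1)" using n by simp
    then have ln0: "0 \<le> ln (real n + 1)" using ln_gt_zero[of 2] by linarith
    show "whitney_const m n (l1_norm n) \<le> ereal (C * ln (real n + 1))"
      unfolding whitney_const_def
    proof (rule SUP_least)
      fix f assume f: "f \<in> {f. continuous_on (unit_ball n (l1_norm n)) f \<and> smoothness_modulus m n (l1_norm n) f \<le> 1}"
      obtain k where k: "2 ^ k \<le> n" "n < 2 ^ (k + 1)"
        using ex_power_ivl1[of 2 n] n by auto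
      obtain \<phi> where \<phi>: "\<phi> \<in> polynomials n (m - 1)"
        "\<And>x. x \<in> l1_ball n 1 \<Longrightarrow> \<bar>f x - \<phi> x\<bar> \<le> A * (real (k + 1) + 1)"
        using upper[of n "k + 1" f] f k by (auto simp: unit_ball_l1)
      have "real k * ln 2 = ln (2 ^ k)" by (simp add: ln_realpow)
      also have "\<dots> \<le> ln (real n + 1)"
      proof -
        have "(2::real) ^ k \<le> real n" using k(1) by (metis of_nat_le_iff of_nat_numeral of_nat_power)
        then have "(2::real) ^ k \<le> real n + 1" by linarith
        then show ?thesis by simp
      qed
      finally have "real k * ln 2 \<le> ln (real n + 1)" .
      then have "(real (k + 1) + 1) * ln 2 \<le> 3 * ln (real n + 1)"
        using ln_pos by (simp only: of_nat_add of_nat_1 distrib_right mult_1_left)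
      then have "real (k + 1) + 1 \<le> 3 * ln (real n + 1) / ln 2"
        by (simp add: pos_le_divide_eq)
      then have "A * (real (k + 1) + 1) \<le> A * (3 * ln (real n + 1) / ln 2)"
        using A by (rule mult_left_mono)
      also have "\<dots> = 3 * A / ln 2 * ln (real n + 1)" by simp
      also have "\<dots> \<le> C * ln (real n + 1)" using C(3) ln0 by (rule mult_right_mono)
      finally have bound: "A * (real (k + 1) + 1) \<le> C * ln (real n + 1)" .
      show "best_approx m n (l1_norm n) f \<le> ereal (C * ln (real n + 1))"
        unfolding best_approx_def
        using order_trans[OF \<phi>(2) bound] by (intro INF_lower2[OF \<phi>(1)] SUP_least) (simp add: unit_ball_l1)
    qed
    define f where "f x = (1 / K) * entropy n x" for x
    have fe: "altsum m (\<lambda>j. f (x + scale (real j) h)) = altsum m (\<lambda>j. entropy n (x + scale (real j) h)) * (1 / K)"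
      for x h unfolding f_def altsum_mult_right[symmetric] by (simp add: mult.commute)
    have "smoothness_modulus m n (l1_norm n) f \<le> ereal 1"
      unfolding smoothness_modulus_le_iff
    proof (intro allI impI)
      fix x h assume "\<forall>j\<le>m. x + scale (real j) h \<in> l1_ball n 1"
      from this[rule_format, of 0] this[rule_format, of m]
      have "\<bar>altsum m (\<lambda>j. entropy n (x + scale (real j) h))\<bar> \<le> K"
        unfolding K_def by (intro abs_altsum_entropy_le assms) auto
      then show "\<bar>altsum m (\<lambda>j. f (x + scale (real j) h))\<bar> \<le> 1"
        unfolding fe using K by (simp add: abs_mult)
    qed
    moreover have "continuous_on (unit_ball n (l1_norm n)) f"
      unfolding f_def by (intro continuous_intros continuous_entropy)
    ultimately have "best_approx m n (l1_norm n) f \<le> whitney_const m n (l1_norm n)"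
      unfolding whitney_const_def by (intro SUP_upper) (simp add: one_ereal_def)
    moreover have "ereal (inverse C * ln (real n + 1)) \<le> best_approx m n (l1_norm n) f"
      unfolding best_approx_def
    proof (rule INF_greatest, rule ccontr)
      fix \<phi> assume \<phi>: "\<phi> \<in> polynomials n (m - 1)"
      let ?S = "SUP x\<in>unit_ball n (l1_norm n). ereal \<bar>f x - \<phi> x\<bar>"
      assume "\<not> ereal (inverse C * ln (real n + 1)) \<le> ?S"
      then have S: "?S < ereal (inverse C * ln (real n + 1))" by simp
      have S0: "ereal \<bar>f x - \<phi> x\<bar> \<le> ?S" if "x \<in> l1_ball n 1" for x
        using that by (intro SUP_upper) (simp add: unit_ball_l1)
      have "\<bar>?S\<bar> \<noteq> \<infinity>"
        using S S0[OF zero_in_l1_ball[of 1 n]] by auto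
      then obtain T where T: "?S = ereal T" by auto
      have "\<bar>entropy n x - K * \<phi> x\<bar> \<le> K * T" if "x \<in> l1_ball n 1" for x
      proof -
        have "\<bar>f x - \<phi> x\<bar> \<le> T" using S0[OF that] unfolding T by simp
        moreover have "entropy n x - K * \<phi> x = K * (f x - \<phi> x)"
          using K by (simp add: f_def right_diff_distrib)
        ultimately show ?thesis using K by (simp add: abs_mult)
      qed
      from lower[OF n polynomials_cmult[OF \<phi>] this]
      have "ln (real n + 1) \<le> W * K * T" by (simp add: mult.assoc)
      also have "T < inverse C * ln (real n + 1)" using S unfolding T by simp
      then have "W * K * T < W * K * (inverse C * ln (real n + 1))" using W K by simp
      also have "\<dots> \<le> C * (inverse C * ln (real n + 1))"
        using C ln0 by (intro mult_right_mono) auto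
      also have "\<dots> = ln (real n + 1)" using C(1) by simp
      finally show False by simp
    qed
    ultimately show "ereal (inverse C * ln (real n + 1)) \<le> whitney_const m n (l1_norm n)"
      by (rule order_trans[rotated])
  qed
qed

end
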